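(* Let $\mathsf n,\mathsf r,\mathsf t,\mathsf f$ be integers with $0\le\mathsf t<\mathsf r\le\mathsf n$ and $\mathsf f\ge2$. The capacity of $\mathsf n$-server, $\mathsf f$-file CSSPIR with $\mathsf r$ responsive servers and $\mathsf t$ colluding servers, i.e. of $(\mathsf r,\mathsf t,\mathsf n,\mathsf f)$-CSSPIR, is $(\mathsf r-\mathsf t)/\mathsf n$.
   Context: Notation: $[n]=\{1,\dots,n\}$; for a tuple $A=(A_1,\dots,A_n)$ and $\mathcal X\subset[n]$, $A_{\mathcal X}=(A_i)_{i\in\mathcal X}$. $I(\cdot;\cdot)$ is mutual information. SPIR protocol ($\mathsf n$ servers, $\mathsf f$ files). Data: finite sets $\mathcal M$ (files, $|\mathcal M|\ge2$), $\mathcal U$ (random seeds), $\mathcal R$ (user randomness), $\mathcal T_j,\mathcal Q_j,\mathcal D_j$ ($j\in[\mathsf n]$), and deterministic maps $h:\mathcal U\to\prod_j\mathcal T_j$, $\phi:[\mathsf f]\times\mathcal R\to\prod_j\mathcal Q_j$, $g_j:\mathcal Q_j\times\mathcal M^{\mathsf f}\times\mathcal T_j\to\mathcal D_j$. The random variables $M=(M_1,\dots,M_{\mathsf f})\in\mathcal M^{\mathsf f}$, $U\in\mathcal U$, $K\in[\mathsf f]$, $R\in\mathcal R$ are uniform and mutually independent; $T=h(U)$, $Q=\phi(K,R)$, $D_j=g_j(Q_j,M,T_j)$, $D=(D_1,\dots,D_{\mathsf n})$. With $\mathfrak A=\{\mathcal A\subset[\mathsf n]:|\mathcal A|\ge\mathsf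 r\}$ and $\mathfrak B=\{\mathcal B\subset[\mathsf n]:|\mathcal B|\le\mathsf t\}$, it is an $(\mathsf r,\mathsf t,\mathsf n,\mathsf f)$-CSSPIR protocol (completely secure SPIR) if: - Correctness: for all $r\in\mathcal R$, $k\in[\mathsf f]$, $\mathcal A\in\mathfrak A$, given $K=k,R=r$ the maximum likelihood decoder of $M_k$ from $D_{\mathcal A}$ has error probability $0$ (i.e. $M_k$ is a function of $D_{\mathcal A}$). - Server secrecy: $I(D;M_{[\mathsf f]\setminus\{k\}}\mid R=r,K=k)=0$ for all $r,k$. - User secrecy: $I(K;Q_{\mathcal B})=0$ for all $\mathcal B\in\mathfrak B$. The PIR rate is $\log|\mathcal M|/\sum_j\log|\mathcal D_j|$. A rate $\rho$ is achievable if there is a sequence of $(\mathsf r,\mathsf t,\mathsf n,\mathsf f)$-CSSPIR protocols whose file sizes $|\mathcal M|$ tend to infinity and whose PIR rates converge to $\rho$. The capacity is the supremum of achievable rates. *)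

theory Defs
  imports "HOL-Probability.Probability"
begin

text \<open>
  A protocol only involves finite sets, so all of them are taken to be finite sets of natural
  numbers; this keeps the alphabets free to vary along a sequence of protocols.  Servers are
  indexed by \<^term>\<open>{1..n}\<close> and files by \<^term>\<open>{1..f}\<close>; tuples are extensional functions on
  their index sets.  The three maps are \<open>h\<close> (\<open>share_map u j\<close> is the \<open>j\<close>-th component of
  \<open>h(u)\<close>), \<open>\<phi>\<close> (\<open>query_map k r j\<close> is the \<open>j\<close>-th component of \<open>\<phi>(k, r)\<close>) and the \<open>g\<^sub>j\<close>
  (\<open>answer_map j q m t\<close> is \<open>g\<^sub>j(q, m, t)\<close>).
\<close>

record spir =
  file_set :: "nat set"
  seed_set :: "nat set"
  rand_set :: "nat set"
  share_set :: "nat \<Rightarrow> nat set"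
  query_set :: "nat \<Rightarrow> nat set"
  answer_set :: "nat \<Rightarrow> nat set"
  share_map :: "nat \<Rightarrow> nat \<Rightarrow> nat"
  query_map :: "nat \<Rightarrow> nat \<Rightarrow> nat \<Rightarrow> nat"
  answer_map :: "nat \<Rightarrow> nat \<Rightarrow> (nat \<Rightarrow> nat) \<Rightarrow> nat \<Rightarrow> nat"

definition file_tuples :: "nat \<Rightarrow> spir \<Rightarrow> (nat \<Rightarrow> nat) set" where
  "file_tuples f P = (\<Pi>\<^sub>E i\<in>{1..f}. file_set P)"

definition spir_protocol :: "nat \<Rightarrow> nat \<Rightarrow> spir \<Rightarrow> bool" where
  "spir_protocol n f P \<longleftrightarrow>
     finite (file_set P) \<and> card (file_set P) \<ge> 2 \<and>
     finite (seed_set P) \<and> seed_set P \<noteq> {} \<and>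
     finite (rand_set P) \<and> rand_set P \<noteq> {} \<and>
     (\<forall>j\<in>{1..n}. finite (share_set P j) \<and> finite (query_set P j) \<and> finite (answer_set P j)) \<and>
     (\<forall>u\<in>seed_set P. share_map P u \<in> (\<Pi>\<^sub>E j\<in>{1..n}. share_set P j)) \<and>
     (\<forall>k\<in>{1..f}. \<forall>r\<in>rand_set P. query_map P k r \<in> (\<Pi>\<^sub>E j\<in>{1..n}. query_set P j)) \<and>
     (\<forall>j\<in>{1..n}. \<forall>q\<in>query_set P j. \<forall>m\<in>file_tuples f P. \<forall>t\<in>share_set P j.
        answer_map P j q m t \<in> answer_set P j)"

text \<open>
  An outcome is \<open>(m, u, k, r)\<close>.  The uniform distribution on the product of the finite ranges
  is the one making all files \<open>M\<^sub>1, \<dots>, M\<^sub>f\<close>, the seed \<open>U\<close>, the index \<open>K\<close> and the user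
  randomness \<open>R\<close> uniform and mutually independent.
\<close>

type_synonym outcome = "(nat \<Rightarrow> nat) \<times> nat \<times> nat \<times> nat"

definition spir_space :: "nat \<Rightarrow> spir \<Rightarrow> outcome measure" where
  "spir_space f P =
     uniform_count_measure (file_tuples f P \<times> seed_set P \<times> {1..f} \<times> rand_set P)"

definition M_rv :: "outcome \<Rightarrow> nat \<Rightarrow> nat" where "M_rv = (\<lambda>(m, u, k, r). m)"
definition U_rv :: "outcome \<Rightarrow> nat" where "U_rv = (\<lambda>(m, u, k, r). u)"
definition K_rv :: "outcome \<Rightarrow> nat" where "K_rv = (\<lambda>(m, u, k, r). k)"
definition R_rv :: "outcome \<Rightarrow> nat" where "R_rv = (\<lambda>(m, u, k, r). r)"

definition T_rv :: "spir \<Rightarrow> outcome \<Rightarrow> nat \<Rightarrow> nat" where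
  "T_rv P \<omega> = share_map P (U_rv \<omega>)"

definition Q_rv :: "spir \<Rightarrow> outcome \<Rightarrow> nat \<Rightarrow> nat" where
  "Q_rv P \<omega> = query_map P (K_rv \<omega>) (R_rv \<omega>)"

definition D_rv :: "spir \<Rightarrow> outcome \<Rightarrow> nat \<Rightarrow> nat" where
  "D_rv P \<omega> j = answer_map P j (Q_rv P \<omega> j) (M_rv \<omega>) (T_rv P \<omega> j)"

definition mutual_info :: "'a measure \<Rightarrow> ('a \<Rightarrow> 'b) \<Rightarrow> ('a \<Rightarrow> 'c) \<Rightarrow> real" where
  "mutual_info \<Omega> X Y =
     prob_space.mutual_information \<Omega> 2
       (count_space (X ` space \<Omega>)) (count_space (Y ` space \<Omega>)) X Y"

definition given_KR :: "nat \<Rightarrow> spir \<Rightarrow> nat \<Rightarrow> nat \<Rightarrow> outcome measure" where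
  "given_KR f P k r =
     uniform_measure (spir_space f P) {\<omega> \<in> space (spir_space f P). K_rv \<omega> = k \<and> R_rv \<omega> = r}"

text \<open>
  Ties in the likelihood are broken by the choice inside \<^const>\<open>arg_max_on\<close>.  As the files are
  uniform, the error probability does not depend on how ties are broken.
\<close>

definition ml_decoder ::
  "nat \<Rightarrow> spir \<Rightarrow> nat \<Rightarrow> nat \<Rightarrow> nat set \<Rightarrow> (nat \<Rightarrow> nat) \<Rightarrow> nat" where
  "ml_decoder f P k r A d =
     arg_max_on (\<lambda>x. \<P>(\<omega> in given_KR f P k r. restrict (D_rv P \<omega>) A = d \<bar> M_rv \<omega> k = x))
       (file_set P)"

definition correct :: "nat \<Rightarrow> nat \<Rightarrow> nat \<Rightarrow> spir \<Rightarrow> bool" where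
  "correct r n f P \<longleftrightarrow>
     (\<forall>w\<in>rand_set P. \<forall>k\<in>{1..f}. \<forall>A. A \<subseteq> {1..n} \<and> card A \<ge> r \<longrightarrow>
        \<P>(\<omega> in given_KR f P k w.
           ml_decoder f P k w A (restrict (D_rv P \<omega>) A) \<noteq> M_rv \<omega> k) = 0)"

definition server_secret :: "nat \<Rightarrow> nat \<Rightarrow> spir \<Rightarrow> bool" where
  "server_secret n f P \<longleftrightarrow>
     (\<forall>w\<in>rand_set P. \<forall>k\<in>{1..f}.
        mutual_info (given_KR f P k w)
          (\<lambda>\<omega>. restrict (D_rv P \<omega>) {1..n})
          (\<lambda>\<omega>. restrict (M_rv \<omega>) ({1..f} - {k})) = 0)"

definition user_secret :: "nat \<Rightarrow> nat \<Rightarrow> nat \<Rightarrow> spir \<Rightarrow> bool" where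
  "user_secret t n f P \<longleftrightarrow>
     (\<forall>B. B \<subseteq> {1..n} \<and> card B \<le> t \<longrightarrow>
        mutual_info (spir_space f P) K_rv (\<lambda>\<omega>. restrict (Q_rv P \<omega>) B) = 0)"

definition csspir :: "nat \<Rightarrow> nat \<Rightarrow> nat \<Rightarrow> nat \<Rightarrow> spir \<Rightarrow> bool" where
  "csspir r t n f P \<longleftrightarrow>
     spir_protocol n f P \<and> correct r n f P \<and> server_secret n f P \<and> user_secret t n f P"

definition pir_rate :: "nat \<Rightarrow> spir \<Rightarrow> real" where
  "pir_rate n P =
     log 2 (real (card (file_set P))) / (\<Sum>j\<in>{1..n}. log 2 (real (card (answer_set P j))))"

definition achievable :: "nat \<Rightarrow> nat \<Rightarrow> nat \<Rightarrow> nat \<Rightarrow> real \<Rightarrow> bool" where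
  "achievable r t n f \<rho> \<longleftrightarrow>
     (\<exists>P. (\<forall>l. csspir r t n f (P l)) \<and>
          filterlim (\<lambda>l::nat. card (file_set (P l))) at_top sequentially \<and>
          (\<lambda>l. pir_rate n (P l)) \<longlonglongrightarrow> \<rho>)"

text \<open>Extended reals make the supremum meaningful without a boundedness proof.\<close>

definition csspir_capacity :: "nat \<Rightarrow> nat \<Rightarrow> nat \<Rightarrow> nat \<Rightarrow> ereal" where
  "csspir_capacity r t n f = (SUP \<rho>\<in>{\<rho>. achievable r t n f \<rho>}. ereal \<rho>)"

end

theory Submission
  imports Defs
begin

text \<open>
  Converse: fix the user's randomness for file 1.  By user secrecy some randomness for file 2 sends
  the same queries to a set \<open>B\<close> of \<open>t\<close> servers, so by server secrecy their answers are independent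
  of \<open>M\<^sub>1\<close>.  Freezing these answers, \<open>M\<^sub>1\<close> still takes all its values and is determined by the
  answers of any further \<open>r - t\<close> servers; hence the answer alphabets of any \<open>r - t\<close> servers have
  at least as many tuples as there are files, and averaging over all choices of the \<open>r - t\<close> servers
  bounds the rate.

  Achievability: over the integers modulo a prime \<open>p > n\<close> let a file be \<open>r - t\<close> symbols.  Queries
  are evaluations at \<open>j\<close> of random polynomials of degree below \<open>t\<close>, with the monomial \<open>X^(t + s)\<close>
  added in the slot of symbol \<open>s\<close> of the requested file.  The answers, masked by a shared random
  polynomial of degree below \<open>t\<close>, are then the values of a polynomial of degree below \<open>r\<close> whose top
  coefficients are the requested file and whose other \<open>t\<close> coefficients are uniform.
\<close>

section \<open>Information-theoretic conditions on finite spaces\<close>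

text \<open>Mutual information is the Kullback-Leibler divergence of the joint law from the product
  of the marginals, which vanishes exactly when the two laws agree. On a finite space both are
  discrete, so agreement is tested on points.\<close>

lemma mutual_info_eq_0_iff:
  assumes "prob_space \<Omega>" and fin: "finite (space \<Omega>)" and sets: "sets \<Omega> = Pow (space \<Omega>)"
  shows "mutual_info \<Omega> X Y = 0 \<longleftrightarrow>
    (\<forall>x\<in>X ` space \<Omega>. \<forall>y\<in>Y ` space \<Omega>.
      measure \<Omega> {\<omega>\<in>space \<Omega>. X \<omega> = x \<and> Y \<omega> = y} =
      measure \<Omega> {\<omega>\<in>space \<Omega>. X \<omega> = x} * measure \<Omega> {\<omega>\<in>space \<Omega>. Y \<omega> = y})"
proof -
  interpret prob_space \<Omega> by fact
  define A B where "A = X ` space \<Omega>" and "B = Y ` space \<Omega>"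
  let ?S = "count_space A" and ?T = "count_space B"
  have finA: "finite A" and finB: "finite B" unfolding A_def B_def using fin by auto
  have X[measurable]: "X \<in> measurable \<Omega> ?S" and Y[measurable]: "Y \<in> measurable \<Omega> ?T"
    by (auto simp: A_def B_def measurable_def sets)
  define Q where "Q = distr \<Omega> (?S \<Otimes>\<^sub>M ?T) (\<lambda>x. (X x, Y x))"
  define P where "P = distr \<Omega> ?S X \<Otimes>\<^sub>M distr \<Omega> ?T Y"
  interpret PX: prob_space "distr \<Omega> ?S X" by (rule prob_space_distr) fact
  interpret PY: prob_space "distr \<Omega> ?T Y" by (rule prob_space_distr) fact
  interpret XY: pair_prob_space "distr \<Omega> ?S X" "distr \<Omega> ?T Y" by standard
  interpret Q: prob_space Q unfolding Q_def by (rule prob_space_distr) simp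
  have pc: "?S \<Otimes>\<^sub>M ?T = count_space (A \<times> B)"
    using finA finB by (rule pair_measure_count_space)
  have sQ: "space Q = A \<times> B" "sets Q = Pow (A \<times> B)"
    unfolding Q_def pc by auto
  have sP: "space P = A \<times> B" "sets P = Pow (A \<times> B)"
  proof -
    have "sets P = sets (?S \<Otimes>\<^sub>M ?T)" unfolding P_def by (intro sets_pair_measure_cong) auto
    then show 1: "sets P = Pow (A \<times> B)" unfolding pc sets_count_space .
    then show "space P = A \<times> B" using sets_eq_imp_space_eq[of P "count_space (A \<times> B)"] by simp
  qed
  have Qpt: "emeasure Q {(x, y)} = ennreal (measure \<Omega> {\<omega>\<in>space \<Omega>. X \<omega> = x \<and> Y \<omega> = y})"
    if "x \<in> A" "y \<in> B" for x y
  proof -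
    have "{(x, y)} \<in> sets (?S \<Otimes>\<^sub>M ?T)" unfolding pc using that by simp
    then show ?thesis unfolding Q_def
      by (subst emeasure_distr) (auto simp: emeasure_eq_measure intro!: arg_cong[where f=prob])
  qed
  have Ppt: "emeasure P {(x, y)} = ennreal (measure \<Omega> {\<omega>\<in>space \<Omega>. X \<omega> = x} * measure \<Omega> {\<omega>\<in>space \<Omega>. Y \<omega> = y})"
    if "x \<in> A" "y \<in> B" for x y
  proof -
    have "emeasure P ({x} \<times> {y}) = emeasure (distr \<Omega> ?S X) {x} * emeasure (distr \<Omega> ?T Y) {y}"
      unfolding P_def using that by (intro PY.emeasure_pair_measure_Times) auto
    also have "emeasure (distr \<Omega> ?S X) {x} = ennreal (measure \<Omega> {\<omega>\<in>space \<Omega>. X \<omega> = x})"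
      using that by (subst emeasure_distr) (auto simp: emeasure_eq_measure intro!: arg_cong[where f=prob])
    also have "emeasure (distr \<Omega> ?T Y) {y} = ennreal (measure \<Omega> {\<omega>\<in>space \<Omega>. Y \<omega> = y})"
      using that by (subst emeasure_distr) (auto simp: emeasure_eq_measure intro!: arg_cong[where f=prob])
    finally show ?thesis by (simp add: ennreal_mult)
  qed
  \<comment> \<open>\<open>P\<close> is the product of the marginals, \<open>Q\<close> the joint
    law. A point of \<open>P\<close>-mass 0 has a marginal of mass 0, which bounds its
    \<open>Q\<close>-mass; finiteness extends this from points to sets.\<close>
  have ac: "absolutely_continuous P Q"
    unfolding absolutely_continuous_def
  proof
    fix N assume "N \<in> null_sets P"
    then have N: "N \<subseteq> A \<times> B" "emeasure P N = 0" using sP by (auto simp: null_sets_def)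
    have "{z} \<in> null_sets Q" if "z \<in> N" for z
    proof -
      obtain x y where z: "z = (x, y)" "x \<in> A" "y \<in> B" using \<open>z \<in> N\<close> N(1) by auto
      have "emeasure P {z} \<le> emeasure P N"
        using that N(1) sP(2) by (intro emeasure_mono) auto
      then have "emeasure P {(x, y)} = 0" using N(2) z(1) by simp
      then have "measure \<Omega> {\<omega>\<in>space \<Omega>. X \<omega> = x} * measure \<Omega> {\<omega>\<in>space \<Omega>. Y \<omega> = y} \<le> 0"
        unfolding Ppt[OF z(2,3)] ennreal_eq_0_iff .
      then have "measure \<Omega> {\<omega>\<in>space \<Omega>. X \<omega> = x} = 0 \<or> measure \<Omega> {\<omega>\<in>space \<Omega>. Y \<omega> = y} = 0"
        by (auto simp: mult_le_0_iff measure_le_0_iff)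
      moreover have "measure \<Omega> {\<omega>\<in>space \<Omega>. X \<omega> = x \<and> Y \<omega> = y} \<le> measure \<Omega> {\<omega>\<in>space \<Omega>. X \<omega> = x}"
        "measure \<Omega> {\<omega>\<in>space \<Omega>. X \<omega> = x \<and> Y \<omega> = y} \<le> measure \<Omega> {\<omega>\<in>space \<Omega>. Y \<omega> = y}"
        by (intro finite_measure_mono; auto simp: sets)+
      ultimately have "measure \<Omega> {\<omega>\<in>space \<Omega>. X \<omega> = x \<and> Y \<omega> = y} \<le> 0"
        by (elim disjE) simp_all
      then have "measure \<Omega> {\<omega>\<in>space \<Omega>. X \<omega> = x \<and> Y \<omega> = y} = 0"
        unfolding measure_le_0_iff .
      then show ?thesis using Qpt[OF z(2,3)] z sQ by (auto simp: null_sets_def)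
    qed
    moreover have "finite N" using N(1) finA finB by (intro finite_subset[OF N(1)] finite_cartesian_product finA finB)
    ultimately have "(\<Union>z\<in>N. {z}) \<in> null_sets Q" by (intro null_sets_UN') (auto intro: countable_finite)
    then show "N \<in> null_sets Q" by simp
  qed
  \<comment> \<open>The divergence criterion also asks for an integrable log density; on a finite
    discrete space every function is bounded, hence integrable.\<close>
  have int: "integrable Q f" for f :: "'b \<times> 'c \<Rightarrow> real"
  proof (rule Q.integrable_const_bound)
    show "f \<in> borel_measurable Q" by (auto simp: measurable_def sQ)
    show "AE x in Q. norm (f x) \<le> Max ((\<lambda>x. norm (f x)) ` (A \<times> B))"
      using finA finB by (intro AE_I2) (auto simp: sQ intro!: Max_ge)
  qed
  interpret P: information_space P 2 unfolding P_def by standard simp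
  have "mutual_info \<Omega> X Y = KL_divergence 2 P Q"
    unfolding mutual_info_def A_def[symmetric] B_def[symmetric] P_def Q_def mutual_information_def ..
  also have "\<dots> = 0 \<longleftrightarrow> Q = P"
    by (rule P.KL_eq_0_iff_eq_ac) (use ac int sP sQ Q.prob_space_axioms in auto)
  also have "\<dots> \<longleftrightarrow> (\<forall>x\<in>A. \<forall>y\<in>B. emeasure P {(x, y)} = emeasure Q {(x, y)})"
  proof safe
    assume *: "\<forall>x\<in>A. \<forall>y\<in>B. emeasure P {(x, y)} = emeasure Q {(x, y)}"
    show "Q = P"
      by (rule measure_eqI_finite[of _ "A \<times> B"]) (use * finA finB sP sQ in auto)
  qed
  also have "\<dots> \<longleftrightarrow> (\<forall>x\<in>A. \<forall>y\<in>B.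
      measure \<Omega> {\<omega>\<in>space \<Omega>. X \<omega> = x \<and> Y \<omega> = y} =
      measure \<Omega> {\<omega>\<in>space \<Omega>. X \<omega> = x} * measure \<Omega> {\<omega>\<in>space \<Omega>. Y \<omega> = y})"
    by (intro ball_cong refl) (auto simp: Ppt Qpt simp flip: ennreal_mult)
  finally show ?thesis unfolding A_def B_def .
qed

text \<open>Injections in both directions between fibres of \<open>Y\<close> that keep
  \<open>X\<close> force each value of \<open>X\<close> to occur equally often in all nonempty
  fibres. This is independence under the uniform law, cleared of denominators. For the scheme the
  injections come from translating the randomness.\<close>

lemma card_indep_of_fibre_injections:
  assumes fin: "finite S"
    and inj: "\<And>y y'. y \<in> Y ` S \<Longrightarrow> y' \<in> Y ` S \<Longrightarrow>
      \<exists>\<tau>. inj_on \<tau> {s\<in>S. Y s = y} \<and> (\<forall>s\<in>S. Y s = y \<longrightarrow> \<tau> s \<in> S \<and> Y (\<tau> s) = y' \<and> X (\<tau> s) = X s)"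
    and y: "y \<in> Y ` S"
  shows "card {s\<in>S. X s = x \<and> Y s = y} * card S = card {s\<in>S. X s = x} * card {s\<in>S. Y s = y}"
proof -
  \<comment> \<open>Counts within a fibre relative to a predicate on \<open>X\<close>: the instances
    \<open>z = x\<close> and \<open>True\<close> give the count of \<open>X = x\<close> and the size
    of the fibre.\<close>
  let ?c = "\<lambda>Q y. card {s\<in>S. Q (X s) \<and> Y s = y}"
  have le: "?c Q y \<le> ?c Q y'" if y1: "y \<in> Y ` S" and y2: "y' \<in> Y ` S" for Q y y'
  proof -
    obtain \<tau> where \<tau>: "inj_on \<tau> {s\<in>S. Y s = y}"
      "\<forall>s\<in>S. Y s = y \<longrightarrow> \<tau> s \<in> S \<and> Y (\<tau> s) = y' \<and> X (\<tau> s) = X s"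
      using inj[OF y1 y2] by blast
    show ?thesis
    proof (rule card_inj_on_le[of \<tau>])
      show "inj_on \<tau> {s\<in>S. Q (X s) \<and> Y s = y}" by (rule inj_on_subset[OF \<tau>(1)]) auto
      show "\<tau> ` {s\<in>S. Q (X s) \<and> Y s = y} \<subseteq> {s\<in>S. Q (X s) \<and> Y s = y'}"
      proof (rule image_subsetI)
        fix s assume "s \<in> {s\<in>S. Q (X s) \<and> Y s = y}"
        then show "\<tau> s \<in> {s\<in>S. Q (X s) \<and> Y s = y'}" using bspec[OF \<tau>(2), of s] by simp
      qed
    qed (simp add: fin)
  qed
  have tot: "card {s\<in>S. Q (X s)} = card (Y ` S) * ?c Q y" for Q
  proof -
    have "card {s\<in>S. Q (X s)} = (\<Sum>z\<in>Y ` S. \<Sum>s\<in>{s \<in> {s\<in>S. Q (X s)}. Y s = z}. 1)"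
      using fin by (subst sum.group) auto
    also have "\<dots> = (\<Sum>z\<in>Y ` S. ?c Q z)" by simp
    also have "\<dots> = (\<Sum>z\<in>Y ` S. ?c Q y)" by (intro sum.cong refl antisym le y)
    finally show ?thesis by simp
  qed
  show ?thesis using tot[of "\<lambda>z. z = x"] tot[of "\<lambda>z. True"] by simp
qed

text \<open>The maximiser is strict against every other value, also outside \<open>S\<close>, so it
  is the only value that the choice in \<open>arg_max_on\<close> can return.\<close>

lemma arg_max_on_eqI:
  fixes f :: "'a \<Rightarrow> 'b::order"
  assumes "a \<in> S" and "\<And>x. x \<noteq> a \<Longrightarrow> f x < f a"
  shows "arg_max_on f S = a"
proof -
  have "is_arg_max f (\<lambda>x. x \<in> S) a"
    unfolding is_arg_max_def using assms by (metis less_asym)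
  then have "is_arg_max f (\<lambda>x. x \<in> S) (arg_max_on f S)"
    unfolding arg_max_on_def arg_max_def by (rule someI)
  then show ?thesis unfolding is_arg_max_def using assms by blast
qed

text \<open>\<open>D_rv\<close> with the outcome split into its coordinates: conditioning on
  \<open>K\<close> and \<open>R\<close> fixes \<open>k\<close> and \<open>w\<close>, and only
  \<open>m\<close> and \<open>u\<close> stay random.\<close>

definition answer :: "spir \<Rightarrow> nat \<Rightarrow> nat \<Rightarrow> (nat \<Rightarrow> nat) \<Rightarrow> nat \<Rightarrow> nat \<Rightarrow> nat" where
  "answer P k w m u j = answer_map P j (query_map P k w j) m (share_map P u j)"

lemma rv_simps [simp]:
  "M_rv (m, u, k, w) = m" "K_rv (m, u, k, w) = k" "R_rv (m, u, k, w) = w"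
  "Q_rv P (m, u, k, w) = query_map P k w" "D_rv P (m, u, k, w) = answer P k w m u"
  by (auto simp: M_rv_def K_rv_def R_rv_def Q_rv_def U_rv_def D_rv_def T_rv_def answer_def)

lemma space_spir_space [simp]:
  "space (spir_space f P) = file_tuples f P \<times> seed_set P \<times> {1..f} \<times> rand_set P"
  by (simp add: spir_space_def space_uniform_count_measure)

lemma sets_spir_space [simp]: "sets (spir_space f P) = Pow (space (spir_space f P))"
  by (simp add: spir_space_def sets_uniform_count_measure space_uniform_count_measure)

lemma space_given_KR [simp]: "space (given_KR f P k w) = space (spir_space f P)"
  by (simp add: given_KR_def)

lemma sets_given_KR [simp]: "sets (given_KR f P k w) = Pow (space (spir_space f P))"
  by (simp add: given_KR_def)

section \<open>Probabilities of a protocol as ratios of counts\<close>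

context
  fixes n f :: nat and P :: spir
  assumes P: "spir_protocol n f P"
begin

lemma finite_file_tuples: "finite (file_tuples f P)"
  and finite_seed_set: "finite (seed_set P)"
  and finite_rand_set: "finite (rand_set P)"
  and seed_set_nonempty: "seed_set P \<noteq> {}"
  and rand_set_nonempty: "rand_set P \<noteq> {}"
  and file_tuples_nonempty: "file_tuples f P \<noteq> {}"
  using P by (auto simp: spir_protocol_def file_tuples_def PiE_eq_empty_iff intro!: finite_PiE)

lemma prob_space_spir_space:
  assumes "f > 0"
  shows "prob_space (spir_space f P)"
  unfolding spir_space_def
  using finite_file_tuples finite_seed_set finite_rand_set
    seed_set_nonempty rand_set_nonempty file_tuples_nonempty assms
  by (intro prob_space_uniform_count_measure) auto

lemma measure_spir_space:
  "measure (spir_space f P) {\<omega>\<in>space (spir_space f P). S \<omega>} =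
    card {\<omega>\<in>space (spir_space f P). S \<omega>} / card (space (spir_space f P))"
  using finite_file_tuples finite_seed_set finite_rand_set
  unfolding space_spir_space by (subst spir_space_def, subst measure_uniform_count_measure) auto

lemma card_given_pos: "card (file_tuples f P \<times> seed_set P) > 0"
  using finite_file_tuples finite_seed_set file_tuples_nonempty seed_set_nonempty
  by (simp add: card_gt_0_iff)

context
  fixes k w :: nat
  assumes k: "k \<in> {1..f}" and w: "w \<in> rand_set P"
begin

lemma emeasure_given:
  "emeasure (spir_space f P) {\<omega>\<in>space (spir_space f P). K_rv \<omega> = k \<and> R_rv \<omega> = w} \<noteq> 0"
proof -
  interpret prob_space "spir_space f P" using prob_space_spir_space k by auto
  let ?E = "{\<omega>\<in>space (spir_space f P). K_rv \<omega> = k \<and> R_rv \<omega> = w}"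
  have "?E \<noteq> {}" using k w file_tuples_nonempty seed_set_nonempty by auto
  moreover have "finite ?E" "finite (space (spir_space f P))"
    using finite_file_tuples finite_seed_set finite_rand_set by auto
  ultimately have "prob ?E \<noteq> 0"
    unfolding measure_spir_space by (auto simp: card_eq_0_iff)
  then show ?thesis by (simp add: emeasure_eq_measure)
qed

lemma prob_space_given_KR: "prob_space (given_KR f P k w)"
proof -
  interpret prob_space "spir_space f P" using prob_space_spir_space k by auto
  show ?thesis unfolding given_KR_def
    using emeasure_given by (intro prob_space_uniform_measure) auto
qed

text \<open>Given \<open>K = k\<close> and \<open>R = w\<close> the pair \<open>(m, u)\<close> is
  still uniform, so conditional probabilities are proportions among such pairs.\<close>

lemma measure_given_KR:
  "measure (given_KR f P k w) {\<omega>\<in>space (spir_space f P). S \<omega>} =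
    card {(m, u) \<in> file_tuples f P \<times> seed_set P. S (m, u, k, w)} / card (file_tuples f P \<times> seed_set P)"
proof -
  interpret prob_space "spir_space f P" using prob_space_spir_space k by auto
  let ?\<Omega> = "space (spir_space f P)" let ?E = "{\<omega>\<in>?\<Omega>. K_rv \<omega> = k \<and> R_rv \<omega> = w}"
  let ?h = "\<lambda>(m, u). (m, u, k, w)"
  have card: "card {\<omega>\<in>?\<Omega>. (K_rv \<omega> = k \<and> R_rv \<omega> = w) \<and> S \<omega>} =
    card {(m, u) \<in> file_tuples f P \<times> seed_set P. S (m, u, k, w)}" for S
  proof -
    have "{\<omega>\<in>?\<Omega>. (K_rv \<omega> = k \<and> R_rv \<omega> = w) \<and> S \<omega>} =
        ?h ` {(m, u) \<in> file_tuples f P \<times> seed_set P. S (m, u, k, w)}"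
      using k w by auto
    then show ?thesis by (simp add: card_image inj_on_def)
  qed
  have fin: "finite ?\<Omega>" "?\<Omega> \<noteq> {}"
    using finite_file_tuples finite_seed_set finite_rand_set k w file_tuples_nonempty seed_set_nonempty by auto
  have "measure (given_KR f P k w) {\<omega>\<in>?\<Omega>. S \<omega>} = prob (?E \<inter> {\<omega>\<in>?\<Omega>. S \<omega>}) / prob ?E"
    unfolding given_KR_def using emeasure_given
    by (intro measure_uniform_measure) (auto simp: emeasure_eq_measure)
  also have "?E \<inter> {\<omega>\<in>?\<Omega>. S \<omega>} = {\<omega>\<in>?\<Omega>. (K_rv \<omega> = k \<and> R_rv \<omega> = w) \<and> S \<omega>}" by auto
  also have "prob \<dots> = card {(m, u) \<in> file_tuples f P \<times> seed_set P. S (m, u, k, w)} / card ?\<Omega>"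
    unfolding measure_spir_space card ..
  also have "prob ?E = card (file_tuples f P \<times> seed_set P) / card ?\<Omega>"
    using card[of "\<lambda>_. True"] unfolding measure_spir_space by simp
  finally show ?thesis using fin by (simp add: card_eq_0_iff)
qed

end

section \<open>Correctness as decodability\<close>

lemma finite_pairs: "finite {(m, u) \<in> file_tuples f P \<times> seed_set P. Z m u}"
  by (rule finite_subset[of _ "file_tuples f P \<times> seed_set P"])
    (use finite_file_tuples finite_seed_set in auto)

lemma card_pairs_pos:
  assumes "m \<in> file_tuples f P" "u \<in> seed_set P" "Z m u"
  shows "card {(m, u) \<in> file_tuples f P \<times> seed_set P. Z m u} > 0"
proof -
  have "(m, u) \<in> {(m, u) \<in> file_tuples f P \<times> seed_set P. Z m u}" using assms by simp
  then have "{(m, u) \<in> file_tuples f P \<times> seed_set P. Z m u} \<noteq> {}" by blast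
  with finite_pairs[of Z] show ?thesis unfolding card_gt_0_iff by (rule conjI[rotated])
qed

text \<open>Under a uniform law, error probability 0 means that no outcome is decoded wrongly. The
  decoder sees only the answers of \<open>A\<close>, so equal answers force equal requested
  files.\<close>

lemma correct_imp_decodable:
  assumes "correct r n f P" and "k \<in> {1..f}" "w \<in> rand_set P" "A \<subseteq> {1..n}" "card A \<ge> r"
    and "m \<in> file_tuples f P" "u \<in> seed_set P" "m' \<in> file_tuples f P" "u' \<in> seed_set P"
    and eq: "\<And>j. j \<in> A \<Longrightarrow> answer P k w m u j = answer P k w m' u' j"
  shows "m k = m' k"
proof -
  let ?err = "\<lambda>\<omega>. ml_decoder f P k w A (restrict (D_rv P \<omega>) A) \<noteq> M_rv \<omega> k"
  have "measure (given_KR f P k w) {\<omega>\<in>space (spir_space f P). ?err \<omega>} = 0"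
    using assms(1-5) unfolding correct_def by simp
  then have "card {(m, u) \<in> file_tuples f P \<times> seed_set P. ?err (m, u, k, w)} = 0"
    unfolding measure_given_KR[OF assms(2,3)] using card_given_pos by simp
  then have "\<not> ?err (m, u, k, w)" "\<not> ?err (m', u', k, w)"
    using card_pairs_pos[of m u "\<lambda>m u. ?err (m, u, k, w)"]
      card_pairs_pos[of m' u' "\<lambda>m u. ?err (m, u, k, w)"] assms(6-9) by auto
  then have "ml_decoder f P k w A (restrict (answer P k w m u) A) = m k"
    "ml_decoder f P k w A (restrict (answer P k w m' u') A) = m' k"
    by simp_all
  moreover have "restrict (answer P k w m u) A = restrict (answer P k w m' u') A"
    using eq by (auto simp: restrict_def)
  ultimately show ?thesis by simp
qed

text \<open>If the answers of \<open>A\<close> determine the requested file, the likelihood is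
  positive at the true file only, and maximum likelihood decoding never errs.\<close>

lemma correctI:
  assumes dec: "\<And>k w A m u m' u'. k \<in> {1..f} \<Longrightarrow> w \<in> rand_set P \<Longrightarrow> A \<subseteq> {1..n} \<Longrightarrow> card A \<ge> r \<Longrightarrow>
    m \<in> file_tuples f P \<Longrightarrow> u \<in> seed_set P \<Longrightarrow> m' \<in> file_tuples f P \<Longrightarrow> u' \<in> seed_set P \<Longrightarrow>
    (\<And>j. j \<in> A \<Longrightarrow> answer P k w m u j = answer P k w m' u' j) \<Longrightarrow> m k = m' k"
  shows "correct r n f P"
  unfolding correct_def
proof (intro ballI allI impI)
  fix w k :: nat and A :: "nat set"
  assume w: "w \<in> rand_set P" and k: "k \<in> {1..f}" and A: "A \<subseteq> {1..n} \<and> card A \<ge> r"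
  have "ml_decoder f P k w A (restrict (answer P k w m u) A) = m k"
    if m: "m \<in> file_tuples f P" and u: "u \<in> seed_set P" for m u
  proof -
    let ?d = "restrict (answer P k w m u) A"
    let ?N = "card (file_tuples f P \<times> seed_set P)"
    let ?L = "\<lambda>x. \<P>(\<omega> in given_KR f P k w. restrict (D_rv P \<omega>) A = ?d \<bar> M_rv \<omega> k = x)"
    have L: "?L x =
        card {(m', u') \<in> file_tuples f P \<times> seed_set P. restrict (answer P k w m' u') A = ?d \<and> m' k = x}
          / ?N /
        (card {(m', u') \<in> file_tuples f P \<times> seed_set P. m' k = x} / ?N)" for x
      unfolding cond_prob_def space_given_KR measure_given_KR[OF k w] rv_simps ..
    \<comment> \<open>This also covers \<open>x\<close> outside the file set: the denominator is
      then 0 and the quotient is 0 by convention.\<close>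
    have other: "?L x = 0" if "x \<noteq> m k" for x
    proof -
      have "{(m', u') \<in> file_tuples f P \<times> seed_set P. restrict (answer P k w m' u') A = ?d \<and> m' k = x} = {}"
      proof (rule ccontr)
        assume "\<not> ?thesis"
        then obtain m' u' where *: "m' \<in> file_tuples f P" "u' \<in> seed_set P"
          "restrict (answer P k w m' u') A = ?d" "m' k = x" by blast
        have "m k = m' k"
        proof (rule dec[OF k w _ _ m u *(1,2)])
          show "answer P k w m u j = answer P k w m' u' j" if "j \<in> A" for j
            using fun_cong[OF *(3), of j] that by simp
        qed (use A in auto)
        then show False using \<open>x \<noteq> m k\<close> *(4) by simp
      qed
      then show ?thesis unfolding L by (simp only: card.empty)
    qed
    have pos: "?L (m k) > 0"
    proof -
      have "card {(m', u') \<in> file_tuples f P \<times> seed_set P. restrict (answer P k w m' u') A = ?d \<and> m' k = m k} > 0"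
        using m u by (intro card_pairs_pos[of m u]) auto
      moreover have "card {(m', u') \<in> file_tuples f P \<times> seed_set P. m' k = m k} > 0"
        using m u by (intro card_pairs_pos[of m u]) auto
      ultimately show ?thesis unfolding L using card_given_pos by simp
    qed
    show ?thesis
      unfolding ml_decoder_def
    proof (rule arg_max_on_eqI)
      show "m k \<in> file_set P" using m k by (auto simp: file_tuples_def)
      show "?L x < ?L (m k)" if "x \<noteq> m k" for x unfolding other[OF that] by (rule pos)
    qed
  qed
  then have "{(m, u) \<in> file_tuples f P \<times> seed_set P. ml_decoder f P k w A (restrict (answer P k w m u) A) \<noteq> m k} = {}"
    by auto
  then show "\<P>(\<omega> in given_KR f P k w. ml_decoder f P k w A (restrict (D_rv P \<omega>) A) \<noteq> M_rv \<omega> k) = 0"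
    unfolding space_given_KR measure_given_KR[OF k w] rv_simps by (simp only: card.empty of_nat_0 div_0)
qed

section \<open>Secrecy conditions as counting statements\<close>

lemma finite_space_spir_space: "finite (space (spir_space f P))"
  using finite_file_tuples finite_seed_set finite_rand_set by simp

lemma mutual_info_given_KR_eq_0_iff:
  assumes "k \<in> {1..f}" and "w \<in> rand_set P"
  shows "mutual_info (given_KR f P k w) X Y = 0 \<longleftrightarrow>
    (\<forall>x\<in>X ` space (spir_space f P). \<forall>y\<in>Y ` space (spir_space f P).
      measure (given_KR f P k w) {\<omega>\<in>space (spir_space f P). X \<omega> = x \<and> Y \<omega> = y} =
      measure (given_KR f P k w) {\<omega>\<in>space (spir_space f P). X \<omega> = x} *
      measure (given_KR f P k w) {\<omega>\<in>space (spir_space f P). Y \<omega> = y})"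
  using mutual_info_eq_0_iff[OF prob_space_given_KR[OF assms], unfolded space_given_KR sets_given_KR,
      OF finite_space_spir_space refl] .

text \<open>Independence makes the joint probability of the given answers and of prescribed
  unrequested files a product of two positive numbers, so some outcome realises both. The prescribed
  files are those of \<open>m\<close> with entry \<open>i\<close> changed to
  \<open>x\<close>.\<close>

lemma server_secret_imp_ex:
  assumes "server_secret n f P" and k: "k \<in> {1..f}" and w: "w \<in> rand_set P"
    and i: "i \<in> {1..f} - {k}" and x: "x \<in> file_set P"
    and m: "m \<in> file_tuples f P" and u: "u \<in> seed_set P"
  shows "\<exists>m'\<in>file_tuples f P. \<exists>u'\<in>seed_set P.
    m' i = x \<and> (\<forall>j\<in>{1..n}. answer P k w m' u' j = answer P k w m u j)"
proof -
  interpret prob_space "given_KR f P k w" by (rule prob_space_given_KR[OF k w])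
  let ?\<Omega> = "space (spir_space f P)"
  let ?d = "restrict (answer P k w m u) {1..n}"
  let ?m = "m(i := x)" let ?y = "restrict ?m ({1..f} - {k})"
  have m': "?m \<in> file_tuples f P" using m i x by (auto simp: file_tuples_def)
  have d: "?d \<in> (\<lambda>\<omega>. restrict (D_rv P \<omega>) {1..n}) ` ?\<Omega>"
    using m u k w by (intro image_eqI[of _ _ "(m, u, k, w)"]) auto
  have y: "?y \<in> (\<lambda>\<omega>. restrict (M_rv \<omega>) ({1..f} - {k})) ` ?\<Omega>"
    using m' u k w by (intro image_eqI[of _ _ "(?m, u, k, w)"]) auto
  let ?c = "\<lambda>Z. card {(m, u) \<in> file_tuples f P \<times> seed_set P. Z m u}"
  let ?N = "card (file_tuples f P \<times> seed_set P)"
  let ?D = "\<lambda>m' u'. restrict (answer P k w m' u') {1..n} = ?d"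
  let ?Y = "\<lambda>m'. restrict m' ({1..f} - {k}) = ?y"
  have "mutual_info (given_KR f P k w) (\<lambda>\<omega>. restrict (D_rv P \<omega>) {1..n})
      (\<lambda>\<omega>. restrict (M_rv \<omega>) ({1..f} - {k})) = 0"
    using assms(1) k w unfolding server_secret_def by blast
  then have "prob {\<omega>\<in>?\<Omega>. restrict (D_rv P \<omega>) {1..n} = ?d \<and> restrict (M_rv \<omega>) ({1..f} - {k}) = ?y} =
      prob {\<omega>\<in>?\<Omega>. restrict (D_rv P \<omega>) {1..n} = ?d} * prob {\<omega>\<in>?\<Omega>. restrict (M_rv \<omega>) ({1..f} - {k}) = ?y}"
    unfolding mutual_info_given_KR_eq_0_iff[OF k w] by (rule bspec[OF bspec[OF _ d] y])
  then have "real (?c (\<lambda>m u. ?D m u \<and> ?Y m)) / ?N = real (?c ?D) / ?N * (real (?c (\<lambda>m u. ?Y m)) / ?N)"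
    unfolding measure_given_KR[OF k w] rv_simps .
  moreover have "?c ?D > 0" "?c (\<lambda>m u. ?Y m) > 0" "?N > 0"
    using card_pairs_pos[of m u ?D, OF m u] card_pairs_pos[of ?m u "\<lambda>m u. ?Y m", OF m' u] card_given_pos by blast+
  then have "real (?c ?D) / ?N * (real (?c (\<lambda>m u. ?Y m)) / ?N) > 0"
    by (intro mult_pos_pos divide_pos_pos; simp only: of_nat_0_less_iff)
  ultimately have "real (?c (\<lambda>m u. ?D m u \<and> ?Y m)) / ?N > 0" by (simp only:)
  then have "?c (\<lambda>m u. ?D m u \<and> ?Y m) \<noteq> 0" by (metis of_nat_0 div_0 less_irrefl)
  then have "{(m, u) \<in> file_tuples f P \<times> seed_set P. ?D m u \<and> ?Y m} \<noteq> {}" by (rule contrapos_nn) (simp only: card.empty)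
  then obtain m1 u1 where *: "m1 \<in> file_tuples f P" "u1 \<in> seed_set P" "?D m1 u1" "?Y m1" by blast
  have "m1 i = x" using fun_cong[OF *(4), of i] i by simp
  moreover have "answer P k w m1 u1 j = answer P k w m u j" if "j \<in> {1..n}" for j
    using fun_cong[OF *(3), of j] that by simp
  ultimately show ?thesis using *(1,2) by blast
qed

text \<open>When a change of the files other than \<open>k\<close> can be compensated by an
  injection of the seeds that preserves all answers, moving files and seed together gives the fibre
  injections of \<open>card_indep_of_fibre_injections\<close>, with \<open>Y\<close> the unrequested
  files.\<close>

lemma server_secretI:
  assumes mask: "\<And>k w m m'. k \<in> {1..f} \<Longrightarrow> w \<in> rand_set P \<Longrightarrow> m \<in> file_tuples f P \<Longrightarrow>
    m' \<in> file_tuples f P \<Longrightarrow> m k = m' k \<Longrightarrow>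
    \<exists>\<sigma>. inj_on \<sigma> (seed_set P) \<and> (\<forall>u\<in>seed_set P. \<sigma> u \<in> seed_set P \<and>
      (\<forall>j\<in>{1..n}. answer P k w m' (\<sigma> u) j = answer P k w m u j))"
  shows "server_secret n f P"
  unfolding server_secret_def
proof (intro ballI)
  fix w k assume w: "w \<in> rand_set P" and k: "k \<in> {1..f}"
  let ?\<Omega> = "space (spir_space f P)"
  let ?S = "file_tuples f P \<times> seed_set P"
  let ?X = "\<lambda>(m, u). restrict (answer P k w m u) {1..n}"
  let ?Y = "\<lambda>(m, u::nat). restrict m ({1..f} - {k})"
  have S: "finite ?S" "?S \<noteq> {}"
    using finite_file_tuples finite_seed_set file_tuples_nonempty seed_set_nonempty by auto
  have indep: "card {s\<in>?S. ?X s = x \<and> ?Y s = y} * card ?S = card {s\<in>?S. ?X s = x} * card {s\<in>?S. ?Y s = y}"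
    if "y \<in> ?Y ` ?S" for x y
  proof (rule card_indep_of_fibre_injections[OF S(1) _ that])
    fix y y' assume "y \<in> ?Y ` ?S" "y' \<in> ?Y ` ?S"
    then obtain m0 where m0: "m0 \<in> file_tuples f P" "y' = restrict m0 ({1..f} - {k})" by auto
    \<comment> \<open>Keeps the requested file and takes the others from \<open>m0\<close>, a
      representative of the target fibre.\<close>
    define \<mu> where "\<mu> m = m0(k := m k)" for m :: "nat \<Rightarrow> nat"
    have \<mu>: "\<mu> m \<in> file_tuples f P" "\<mu> m k = m k" if "m \<in> file_tuples f P" for m
      using that m0(1) k by (auto simp: \<mu>_def file_tuples_def PiE_iff extensional_def)
    have "\<exists>\<sigma>. \<forall>m\<in>file_tuples f P. inj_on (\<sigma> m) (seed_set P) \<and> (\<forall>u\<in>seed_set P. \<sigma> m u \<in> seed_set P \<and>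
        (\<forall>j\<in>{1..n}. answer P k w (\<mu> m) (\<sigma> m u) j = answer P k w m u j))"
    proof (intro bchoice ballI)
      fix m assume m: "m \<in> file_tuples f P"
      show "\<exists>\<sigma>. inj_on \<sigma> (seed_set P) \<and> (\<forall>u\<in>seed_set P. \<sigma> u \<in> seed_set P \<and>
          (\<forall>j\<in>{1..n}. answer P k w (\<mu> m) (\<sigma> u) j = answer P k w m u j))"
        by (rule mask[OF k w m \<mu>(1)[OF m] \<mu>(2)[OF m, symmetric]])
    qed
    then obtain \<sigma> where \<sigma>: "\<And>m. m \<in> file_tuples f P \<Longrightarrow> inj_on (\<sigma> m) (seed_set P)"
      "\<And>m u. m \<in> file_tuples f P \<Longrightarrow> u \<in> seed_set P \<Longrightarrow> \<sigma> m u \<in> seed_set P"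
      "\<And>m u j. m \<in> file_tuples f P \<Longrightarrow> u \<in> seed_set P \<Longrightarrow> j \<in> {1..n} \<Longrightarrow>
        answer P k w (\<mu> m) (\<sigma> m u) j = answer P k w m u j"
      by blast
    show "\<exists>\<tau>. inj_on \<tau> {s\<in>?S. ?Y s = y} \<and> (\<forall>s\<in>?S. ?Y s = y \<longrightarrow> \<tau> s \<in> ?S \<and> ?Y (\<tau> s) = y' \<and> ?X (\<tau> s) = ?X s)"
    proof (intro exI conjI ballI impI)
      let ?\<tau> = "\<lambda>(m, u). (\<mu> m, \<sigma> m u)"
      show "inj_on ?\<tau> {s\<in>?S. ?Y s = y}"
      proof (rule inj_onI, clarify)
        fix m1 u1 m2 u2
        assume m1: "m1 \<in> file_tuples f P" "u1 \<in> seed_set P" and m2: "m2 \<in> file_tuples f P" "u2 \<in> seed_set P"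
          and y: "restrict m2 ({1..f} - {k}) = restrict m1 ({1..f} - {k})"
          and eq: "\<mu> m1 = \<mu> m2" "\<sigma> m1 u1 = \<sigma> m2 u2"
        \<comment> \<open>Coordinate \<open>k\<close> survives in \<open>\<mu>\<close>, the other
          files are fixed by the fibre, and outside \<open>{1..f}\<close> both tuples are undefined
          by extensionality.\<close>
        have "m1 i = m2 i" for i
        proof -
          consider "i = k" | "i \<in> {1..f} - {k}" | "i \<notin> {1..f}" by blast
          then show ?thesis
          proof cases
            case 1
            then show ?thesis using fun_cong[OF eq(1), of k] by (simp add: \<mu>_def)
          next
            case 2
            then show ?thesis using fun_cong[OF y, of i] by simp
          next
            case 3
            then show ?thesis
              using PiE_arb[OF m1(1)[unfolded file_tuples_def], of i]
                PiE_arb[OF m2(1)[unfolded file_tuples_def], of i] by simp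
          qed
        qed
        then have "m1 = m2" by blast
        moreover have "u1 = u2"
          using eq(2) inj_onD[OF \<sigma>(1)[OF m1(1)] _ m1(2) m2(2)] \<open>m1 = m2\<close> by simp
        ultimately show "m1 = m2 \<and> u1 = u2" ..
      qed
      fix s assume s: "s \<in> ?S"
      obtain m u where mu: "s = (m, u)" "m \<in> file_tuples f P" "u \<in> seed_set P" using s by auto
      show "?\<tau> s \<in> ?S" using mu \<mu>(1) \<sigma>(2) by simp
      show "?Y (?\<tau> s) = y'" using mu m0(2) by (auto simp: \<mu>_def fun_eq_iff)
      show "?X (?\<tau> s) = ?X s" using mu \<sigma>(3) by (auto intro!: restrict_ext)
    qed
  qed
  have conv: "{(m, u) \<in> ?S. restrict (answer P k w m u) {1..n} = x} = {s\<in>?S. ?X s = x}"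
    "{(m, u) \<in> ?S. restrict m ({1..f} - {k}) = y} = {s\<in>?S. ?Y s = y}"
    "{(m, u) \<in> ?S. restrict (answer P k w m u) {1..n} = x \<and> restrict m ({1..f} - {k}) = y} =
      {s\<in>?S. ?X s = x \<and> ?Y s = y}" for x y
    by auto
  show "mutual_info (given_KR f P k w) (\<lambda>\<omega>. restrict (D_rv P \<omega>) {1..n})
      (\<lambda>\<omega>. restrict (M_rv \<omega>) ({1..f} - {k})) = 0"
    unfolding mutual_info_given_KR_eq_0_iff[OF k w]
  proof (intro ballI)
    fix x y assume "y \<in> (\<lambda>\<omega>. restrict (M_rv \<omega>) ({1..f} - {k})) ` ?\<Omega>"
    then have "y \<in> ?Y ` ?S" by auto
    from indep[OF this, of x] have "real (card {s\<in>?S. ?X s = x \<and> ?Y s = y}) * real (card ?S) =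
      real (card {s\<in>?S. ?X s = x}) * real (card {s\<in>?S. ?Y s = y})"
      by (simp only: flip: of_nat_mult)
    then show "measure (given_KR f P k w) {\<omega>\<in>?\<Omega>. restrict (D_rv P \<omega>) {1..n} = x \<and> restrict (M_rv \<omega>) ({1..f} - {k}) = y} =
      measure (given_KR f P k w) {\<omega>\<in>?\<Omega>. restrict (D_rv P \<omega>) {1..n} = x} *
      measure (given_KR f P k w) {\<omega>\<in>?\<Omega>. restrict (M_rv \<omega>) ({1..f} - {k}) = y}"
      unfolding measure_given_KR[OF k w] rv_simps conv
      using S by (simp add: field_simps)
  qed
qed

text \<open>The positivity argument for server secrecy, now applied to \<open>K\<close> and the
  queries to \<open>B\<close>: a query pattern that is possible for \<open>k\<close> also has
  positive probability jointly with \<open>k'\<close>.\<close>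

lemma user_secret_imp_ex:
  assumes "user_secret t n f P" and k: "k \<in> {1..f}" "k' \<in> {1..f}" and w: "w \<in> rand_set P"
    and B: "B \<subseteq> {1..n}" "card B \<le> t"
  shows "\<exists>w'\<in>rand_set P. \<forall>j\<in>B. query_map P k' w' j = query_map P k w j"
proof -
  interpret prob_space "spir_space f P" using prob_space_spir_space k by auto
  let ?\<Omega> = "space (spir_space f P)"
  note fin = finite_space_spir_space
  obtain m u where mu: "m \<in> file_tuples f P" "u \<in> seed_set P"
    using file_tuples_nonempty seed_set_nonempty by auto
  have o: "(m, u, k, w) \<in> ?\<Omega>" "(m, u, k', w) \<in> ?\<Omega>" using mu k w by auto
  let ?q = "restrict (query_map P k w) B"
  have pos: "prob {\<omega>\<in>?\<Omega>. Z \<omega>} > 0" if "\<omega> \<in> ?\<Omega>" "Z \<omega>" for Z \<omega>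
  proof -
    have "\<omega> \<in> {\<omega>\<in>?\<Omega>. Z \<omega>}" using that by simp
    then have "{\<omega>\<in>?\<Omega>. Z \<omega>} \<noteq> {}" "?\<Omega> \<noteq> {}" using that by blast+
    moreover have "finite {\<omega>\<in>?\<Omega>. Z \<omega>}" by (rule finite_subset[OF _ fin]) auto
    ultimately show ?thesis
      unfolding measure_spir_space using fin
      by (intro divide_pos_pos; simp only: of_nat_0_less_iff card_gt_0_iff simp_thms)
  qed
  have k': "k' \<in> K_rv ` ?\<Omega>" by (rule image_eqI[OF _ o(2)]) simp
  have q: "?q \<in> (\<lambda>\<omega>. restrict (Q_rv P \<omega>) B) ` ?\<Omega>" by (rule image_eqI[OF _ o(1)]) simp
  have "mutual_info (spir_space f P) K_rv (\<lambda>\<omega>. restrict (Q_rv P \<omega>) B) = 0"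
    using assms(1) B unfolding user_secret_def by blast
  then have "prob {\<omega>\<in>?\<Omega>. K_rv \<omega> = k' \<and> restrict (Q_rv P \<omega>) B = ?q} =
    prob {\<omega>\<in>?\<Omega>. K_rv \<omega> = k'} * prob {\<omega>\<in>?\<Omega>. restrict (Q_rv P \<omega>) B = ?q}"
    unfolding mutual_info_eq_0_iff[OF prob_space_axioms fin sets_spir_space]
    by (rule bspec[OF bspec[OF _ k'] q])
  also have "\<dots> > 0"
    using pos[OF o(2), of "\<lambda>\<omega>. K_rv \<omega> = k'"] pos[OF o(1), of "\<lambda>\<omega>. restrict (Q_rv P \<omega>) B = ?q"] by simp
  finally have "{\<omega>\<in>?\<Omega>. K_rv \<omega> = k' \<and> restrict (Q_rv P \<omega>) B = ?q} \<noteq> {}"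
    by (metis less_irrefl measure_empty)
  then obtain w' where w': "w' \<in> rand_set P" "restrict (query_map P k' w') B = ?q" by auto
  have "query_map P k' w' j = query_map P k w j" if "j \<in> B" for j
    using fun_cong[OF w'(2), of j] that by simp
  then show ?thesis using w'(1) by blast
qed

text \<open>The injection of the user randomness leaves the queries to \<open>B\<close> unchanged
  while the index moves from \<open>k\<close> to \<open>k'\<close>. With files and seed held fixed,
  this is an injection between fibres of \<open>K\<close>.\<close>

lemma user_secretI:
  assumes f: "f > 0" and shift: "\<And>k k' B. k \<in> {1..f} \<Longrightarrow> k' \<in> {1..f} \<Longrightarrow> B \<subseteq> {1..n} \<Longrightarrow> card B \<le> t \<Longrightarrow>
    \<exists>\<sigma>. inj_on \<sigma> (rand_set P) \<and> (\<forall>w\<in>rand_set P. \<sigma> w \<in> rand_set P \<and>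
      (\<forall>j\<in>B. query_map P k' (\<sigma> w) j = query_map P k w j))"
  shows "user_secret t n f P"
  unfolding user_secret_def
proof (intro allI impI)
  fix B assume B: "B \<subseteq> {1..n} \<and> card B \<le> t"
  interpret prob_space "spir_space f P" using prob_space_spir_space f by auto
  let ?\<Omega> = "space (spir_space f P)"
  note fin = finite_space_spir_space
  let ?X = "\<lambda>\<omega>. restrict (Q_rv P \<omega>) B"
  have indep: "card {s\<in>?\<Omega>. ?X s = x \<and> K_rv s = y} * card ?\<Omega> = card {s\<in>?\<Omega>. ?X s = x} * card {s\<in>?\<Omega>. K_rv s = y}"
    if "y \<in> K_rv ` ?\<Omega>" for x y
  proof (rule card_indep_of_fibre_injections[OF fin _ that])
    fix k k' assume "k \<in> K_rv ` ?\<Omega>" "k' \<in> K_rv ` ?\<Omega>"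
    then have k: "k \<in> {1..f}" "k' \<in> {1..f}" by auto
    have "\<exists>\<sigma>. inj_on \<sigma> (rand_set P) \<and> (\<forall>w\<in>rand_set P. \<sigma> w \<in> rand_set P \<and>
        (\<forall>j\<in>B. query_map P k' (\<sigma> w) j = query_map P k w j))"
      using B by (intro shift[OF k]) auto
    then obtain \<sigma> where \<sigma>: "inj_on \<sigma> (rand_set P)" "\<And>w. w \<in> rand_set P \<Longrightarrow> \<sigma> w \<in> rand_set P"
      "\<And>w j. w \<in> rand_set P \<Longrightarrow> j \<in> B \<Longrightarrow> query_map P k' (\<sigma> w) j = query_map P k w j"
      by blast
    let ?\<tau> = "\<lambda>(m, u, k, w). (m, u, k', \<sigma> w)"
    show "\<exists>\<tau>. inj_on \<tau> {s\<in>?\<Omega>. K_rv s = k} \<and>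
      (\<forall>s\<in>?\<Omega>. K_rv s = k \<longrightarrow> \<tau> s \<in> ?\<Omega> \<and> K_rv (\<tau> s) = k' \<and> ?X (\<tau> s) = ?X s)"
    proof (intro exI conjI ballI impI)
      show "inj_on ?\<tau> {s\<in>?\<Omega>. K_rv s = k}"
      proof (rule inj_onI)
        fix s s' assume "s \<in> {s\<in>?\<Omega>. K_rv s = k}" "s' \<in> {s\<in>?\<Omega>. K_rv s = k}" "?\<tau> s = ?\<tau> s'"
        then show "s = s'" using inj_onD[OF \<sigma>(1)] by (cases s; cases s') simp
      qed
      fix s assume s: "s \<in> ?\<Omega>" "K_rv s = k"
      obtain m u w where mu: "s = (m, u, k, w)" "m \<in> file_tuples f P" "u \<in> seed_set P" "w \<in> rand_set P"
        using s by auto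
      show "?\<tau> s \<in> ?\<Omega>" using mu k(2) \<sigma>(2) by simp
      show "K_rv (?\<tau> s) = k'" using mu by simp
      show "?X (?\<tau> s) = ?X s" using mu \<sigma>(3) by (auto intro!: restrict_ext)
    qed
  qed
  have pos: "card ?\<Omega> > 0" using fin not_empty by (simp only: card_gt_0_iff) simp
  show "mutual_info (spir_space f P) K_rv ?X = 0"
    unfolding mutual_info_eq_0_iff[OF prob_space_axioms fin sets_spir_space]
  proof (intro ballI)
    fix y x assume "y \<in> K_rv ` ?\<Omega>"
    from indep[OF this, of x] have "real (card {s\<in>?\<Omega>. ?X s = x \<and> K_rv s = y}) * real (card ?\<Omega>) =
      real (card {s\<in>?\<Omega>. ?X s = x}) * real (card {s\<in>?\<Omega>. K_rv s = y})"
      by (simp only: flip: of_nat_mult)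
    moreover have "{s\<in>?\<Omega>. K_rv s = y \<and> ?X s = x} = {s\<in>?\<Omega>. ?X s = x \<and> K_rv s = y}" by blast
    ultimately show "prob {s\<in>?\<Omega>. K_rv s = y \<and> ?X s = x} = prob {s\<in>?\<Omega>. K_rv s = y} * prob {s\<in>?\<Omega>. ?X s = x}"
      unfolding measure_spir_space using pos by (simp add: field_simps del: space_spir_space)
  qed
qed

end

section \<open>The converse\<close>

text \<open>Double counting: summing the hypothesis over all \<open>c\<close>-subsets counts each
  element \<open>(card N - 1) choose (c - 1)\<close> times.\<close>

lemma sum_le_average_over_subsets:
  fixes a :: "'a \<Rightarrow> real"
  assumes N: "finite N" "0 < c" "c \<le> card N"
    and le: "\<And>C. C \<subseteq> N \<Longrightarrow> card C = c \<Longrightarrow> x \<le> sum a C"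
  shows "real (card N) * x \<le> real c * sum a N"
proof -
  let ?S = "{C. C \<subseteq> N \<and> card C = c}"
  have fin: "finite ?S" using N(1) by simp
  have deg: "card {C\<in>?S. j \<in> C} = (card N - 1) choose (c - 1)" if j: "j \<in> N" for j
  proof -
    have "bij_betw (insert j) {C. C \<subseteq> N - {j} \<and> card C = c - 1} {C\<in>?S. j \<in> C}"
    proof (rule bij_betw_byWitness[where f' = "\<lambda>C. C - {j}"])
      show "insert j ` {C. C \<subseteq> N - {j} \<and> card C = c - 1} \<subseteq> {C\<in>?S. j \<in> C}"
      proof (intro image_subsetI)
        fix C assume C: "C \<in> {C. C \<subseteq> N - {j} \<and> card C = c - 1}"
        then have "finite C" "j \<notin> C" using N(1) finite_subset by auto
        then show "insert j C \<in> {C\<in>?S. j \<in> C}" using C j N(2) by auto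
      qed
    qed (use N(1) finite_subset j in auto)
    then have "card {C\<in>?S. j \<in> C} = card {C. C \<subseteq> N - {j} \<and> card C = c - 1}"
      by (simp add: bij_betw_same_card)
    also have "\<dots> = (card (N - {j})) choose (c - 1)" using N(1) by (intro n_subsets) simp
    finally show ?thesis using j N(1) by simp
  qed
  have "real (card ?S) * x = (\<Sum>C\<in>?S. x)" by simp
  also have "\<dots> \<le> (\<Sum>C\<in>?S. sum a C)" using le by (intro sum_mono) auto
  also have "\<dots> = (\<Sum>C\<in>?S. \<Sum>j\<in>{j\<in>N. j \<in> C}. a j)"
    by (intro sum.cong refl) auto
  also have "\<dots> = (\<Sum>j\<in>N. \<Sum>C\<in>{C\<in>?S. j \<in> C}. a j)"
    by (rule sum.swap_restrict[OF fin N(1)])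
  also have "\<dots> = (\<Sum>j\<in>N. real ((card N - 1) choose (c - 1)) * a j)"
    using deg by (intro sum.cong refl) simp
  finally have "real (card N choose c) * x \<le> real ((card N - 1) choose (c - 1)) * sum a N"
    using N(1) by (simp add: n_subsets sum_distrib_left)
  \<comment> \<open>The factor \<open>card N\<close> brings in the absorption identity for binomial
    coefficients, after which the positive \<open>card N choose c\<close> cancels.\<close>
  then have "real (card N) * (real (card N choose c) * x) \<le>
      real (card N * ((card N - 1) choose (c - 1))) * sum a N"
    by (simp add: mult_left_mono mult.assoc)
  also have "card N * ((card N - 1) choose (c - 1)) = c * (card N choose c)"
    using times_binomial_minus1_eq[OF N(2), of "card N"] by simp
  finally have "real (card N choose c) * (real (card N) * x) \<le> real (card N choose c) * (real c * sum a N)"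
    by (simp add: mult_ac)
  moreover have "card N choose c > 0" using N(3) by simp
  ultimately show ?thesis by (simp add: mult_le_cancel_left_pos)
qed

text \<open>\<open>C\<close> together with \<open>t\<close> colluding servers decodes file 1. Since
  the answers of the latter can be held constant while file 1 takes every value, those of
  \<open>C\<close> alone separate the files.\<close>

lemma csspir_card_file_set_le:
  assumes "csspir r t n f P" and "f \<ge> 2" "t < r" "r \<le> n" and C: "C \<subseteq> {1..n}" "card C = r - t"
  shows "card (file_set P) \<le> (\<Prod>j\<in>C. card (answer_set P j))"
proof -
  have P: "spir_protocol n f P" "correct r n f P" "server_secret n f P" "user_secret t n f P"
    using assms(1) unfolding csspir_def by auto
  have finC: "finite C" using C finite_subset by auto
  have "card ({1..n} - C) = n - (r - t)" using C by (simp add: card_Diff_subset finC)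
  then have "t \<le> card ({1..n} - C)" using assms(3,4) by linarith
  \<comment> \<open>\<open>r \<le> n\<close> leaves room for \<open>t\<close> servers outside
    \<open>C\<close>, and \<open>B\<close> together with \<open>C\<close> is then large enough to
    decode.\<close>
  then obtain B where B: "B \<subseteq> {1..n} - C" "card B = t" by (meson obtain_subset_with_card_n)
  have A: "B \<union> C \<subseteq> {1..n}" "card (B \<union> C) \<ge> r"
  proof -
    have "finite B" using B finite_subset by auto
    then have "card (B \<union> C) = card B + card C" using B finC by (intro card_Un_disjoint) auto
    then show "card (B \<union> C) \<ge> r" using B C by simp
  qed (use B C in auto)
  obtain w where w: "w \<in> rand_set P" using rand_set_nonempty[OF P(1)] by auto
  have one: "(1::nat) \<in> {1..f}" and two: "(2::nat) \<in> {1..f}" using assms(2) by auto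
  have B': "B \<subseteq> {1..n}" "card B \<le> t" using B by auto
  \<comment> \<open>\<open>B\<close> is small enough to learn nothing about the index, so its
    queries for file 1 under \<open>w\<close> also occur for file 2, under some \<open>w'\<close>;
    its answers then coincide for all files and seeds.\<close>
  obtain w' where w': "w' \<in> rand_set P" "\<And>j. j \<in> B \<Longrightarrow> query_map P 2 w' j = query_map P 1 w j"
    using user_secret_imp_ex[OF P(1,4) one two w B'] by blast
  have answers: "answer P 2 w' m u j = answer P 1 w m u j" if "j \<in> B" for m u j
    unfolding answer_def w'(2)[OF that] ..
  obtain m0 u0 where mu0: "m0 \<in> file_tuples f P" "u0 \<in> seed_set P"
    using file_tuples_nonempty[OF P(1)] seed_set_nonempty[OF P(1)] by auto
  have i: "(1::nat) \<in> {1..f} - {2}" using one by simp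
  \<comment> \<open>When file 2 is requested, secrecy protects file 1: every value \<open>x\<close>
    of file 1 is compatible with the answers at the reference point \<open>(m0, u0)\<close>.\<close>
  have "\<forall>x\<in>file_set P. \<exists>mu. fst mu \<in> file_tuples f P \<and> snd mu \<in> seed_set P \<and> fst mu 1 = x \<and>
      (\<forall>j\<in>{1..n}. answer P 2 w' (fst mu) (snd mu) j = answer P 2 w' m0 u0 j)"
    using server_secret_imp_ex[OF P(1,3) two w'(1) i _ mu0] by fastforce
  then obtain \<mu> where \<mu>: "\<And>x. x \<in> file_set P \<Longrightarrow> fst (\<mu> x) \<in> file_tuples f P"
    "\<And>x. x \<in> file_set P \<Longrightarrow> snd (\<mu> x) \<in> seed_set P"
    "\<And>x. x \<in> file_set P \<Longrightarrow> fst (\<mu> x) 1 = x"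
    "\<And>x j. x \<in> file_set P \<Longrightarrow> j \<in> {1..n} \<Longrightarrow>
      answer P 2 w' (fst (\<mu> x)) (snd (\<mu> x)) j = answer P 2 w' m0 u0 j"
    unfolding bchoice_iff by blast
  let ?G = "\<lambda>x. \<lambda>j\<in>C. answer P 1 w (fst (\<mu> x)) (snd (\<mu> x)) j"
  have inj: "inj_on ?G (file_set P)"
  proof (rule inj_onI)
    fix x y assume x: "x \<in> file_set P" and y: "y \<in> file_set P" and eq: "?G x = ?G y"
    have "answer P 1 w (fst (\<mu> x)) (snd (\<mu> x)) j = answer P 1 w (fst (\<mu> y)) (snd (\<mu> y)) j"
      if "j \<in> B \<union> C" for j
    proof (cases "j \<in> C")
      case True
      then show ?thesis using fun_cong[OF eq, of j] by simp
    next
      case False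
      then have j: "j \<in> B" "j \<in> {1..n}" using that B by auto
      \<comment> \<open>On \<open>B\<close> the answers to a request for file 1 equal those for file
        2, which are frozen at those of \<open>(m0, u0)\<close>.\<close>
      show ?thesis using \<mu>(4)[OF x j(2)] \<mu>(4)[OF y j(2)] unfolding answers[OF j(1)] by simp
    qed
    then have "fst (\<mu> x) 1 = fst (\<mu> y) 1"
      by (rule correct_imp_decodable[OF P(1,2) one w A \<mu>(1,2)[OF x] \<mu>(1,2)[OF y]])
    then show "x = y" using \<mu>(3) x y by simp
  qed
  have maps: "\<forall>u\<in>seed_set P. share_map P u \<in> (\<Pi>\<^sub>E j\<in>{1..n}. share_set P j)"
    "query_map P 1 w \<in> (\<Pi>\<^sub>E j\<in>{1..n}. query_set P j)"
    using P(1) one w unfolding spir_protocol_def by blast+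
  have prot: "\<And>j q m \<tau>. j \<in> {1..n} \<Longrightarrow> q \<in> query_set P j \<Longrightarrow> m \<in> file_tuples f P \<Longrightarrow> \<tau> \<in> share_set P j \<Longrightarrow>
      answer_map P j q m \<tau> \<in> answer_set P j"
    "\<And>u j. u \<in> seed_set P \<Longrightarrow> j \<in> {1..n} \<Longrightarrow> share_map P u j \<in> share_set P j"
    "\<And>j. j \<in> {1..n} \<Longrightarrow> query_map P 1 w j \<in> query_set P j"
    "\<And>j. j \<in> {1..n} \<Longrightarrow> finite (answer_set P j)"
    using P(1) PiE_mem[OF bspec[OF maps(1)]] PiE_mem[OF maps(2)] unfolding spir_protocol_def by simp_all
  have "?G ` file_set P \<subseteq> (\<Pi>\<^sub>E j\<in>C. answer_set P j)"
  proof (intro image_subsetI restrict_PiE_iff[THEN iffD2] ballI)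
    fix x j assume "x \<in> file_set P" "j \<in> C"
    then show "answer P 1 w (fst (\<mu> x)) (snd (\<mu> x)) j \<in> answer_set P j"
      unfolding answer_def using C(1) \<mu>(1,2) by (intro prot) auto
  qed
  then have "card (file_set P) \<le> card (\<Pi>\<^sub>E j\<in>C. answer_set P j)"
    using inj C(1) prot(4) by (intro card_inj_on_le[of ?G] finite_PiE finC) auto
  then show ?thesis by (simp add: card_PiE finC)
qed

text \<open>In logarithms the product bound says that the download from any \<open>r - t\<close>
  servers is at least the file size; averaging over all such sets of servers bounds the total
  download from below.\<close>

lemma csspir_rate_le:
  assumes "csspir r t n f P" and "f \<ge> 2" "t < r" "r \<le> n"
  shows "pir_rate n P \<le> (real r - real t) / real n"
proof -
  have P: "spir_protocol n f P" using assms(1) unfolding csspir_def by auto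
  define a where "a j = log 2 (real (card (answer_set P j)))" for j
  let ?x = "log 2 (real (card (file_set P)))"
  have M: "card (file_set P) \<ge> 2" using P unfolding spir_protocol_def by auto
  then have x: "?x \<ge> 1" by simp
  have le: "?x \<le> sum a C" if C: "C \<subseteq> {1..n}" "card C = r - t" for C
  proof -
    have bound: "card (file_set P) \<le> (\<Prod>j\<in>C. card (answer_set P j))"
      by (rule csspir_card_file_set_le[OF assms C])
    have finC: "finite C" using C finite_subset by auto
    \<comment> \<open>A product that is at least 2 has no zero factor, so the logarithm of the
      product splits.\<close>
    have pos: "0 < card (answer_set P j)" if "j \<in> C" for j
      using bound M that finC by (metis not_gr_zero not_numeral_le_zero le_zero_eq prod_zero_iff)
    have "?x \<le> log 2 (real (\<Prod>j\<in>C. card (answer_set P j)))"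
      using bound M by (subst log_le_cancel_iff) (auto simp only: of_nat_le_iff)
    also have "\<dots> = sum a C"
      unfolding a_def of_nat_prod log_def using pos finC
      by (subst ln_prod) (auto simp: sum_divide_distrib)
    finally show ?thesis .
  qed
  have "real (card {1..n}) * ?x \<le> real (r - t) * sum a {1..n}"
    using assms le by (intro sum_le_average_over_subsets) auto
  then have *: "real n * ?x \<le> (real r - real t) * sum a {1..n}"
    using assms(3) by simp
  have n: "real n > 0" using assms by simp
  have "0 < real n * ?x" using n x by simp
  then have "0 < (real r - real t) * sum a {1..n}" using * by linarith
  then have "0 < sum a {1..n}" using assms(3) by (simp add: zero_less_mult_iff)
  then show ?thesis
    unfolding pir_rate_def a_def[symmetric] using * n by (simp add: field_simps)
qed

section \<open>Polynomials modulo a prime\<close>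

text \<open>Interpolation by repeated division by \<open>X - b\<close>: this divisor is monic, so no
  inverses are needed and the coefficients stay integral, ready to be reduced modulo
  \<open>p\<close>.\<close>

lemma poly_interpolation_int:
  fixes F :: "int poly"
  assumes "finite B"
  shows "\<exists>g. (\<forall>b\<in>B. poly g b = poly F b) \<and> (\<forall>i\<ge>card B. coeff g i = 0)"
  using assms
proof (induction B arbitrary: F rule: finite_induct)
  case empty
  then show ?case by (intro exI[of _ 0]) auto
next
  case (insert b B)
  \<comment> \<open>The quotient is interpolated on the remaining points; \<open>F\<close> equals
    its value at \<open>b\<close> plus \<open>X - b\<close> times the quotient.\<close>
  obtain g where g: "\<forall>x\<in>B. poly g x = poly (synthetic_div F b) x" "\<forall>i\<ge>card B. coeff g i = 0"
    using insert.IH by blast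
  have F: "poly F x = poly F b + (x - b) * poly (synthetic_div F b) x" for x
    using arg_cong[OF synthetic_div_correct'[of b F], of "\<lambda>p. poly p x"] by (simp add: algebra_simps)
  let ?g = "[:poly F b:] + [:-b, 1:] * g"
  have "poly ?g x = poly F x" if "x \<in> insert b B" for x
    using that g(1) F[of x] by (auto simp: algebra_simps)
  moreover have "coeff ?g i = 0" if "i \<ge> card (insert b B)" for i
    using that g(2) insert by (cases i) auto
  ultimately show ?case by blast
qed

text \<open>The root bound over the field of \<open>p\<close> elements, phrased for integer
  polynomials: splitting off the root \<open>a\<close> leaves a quotient that vanishes modulo
  \<open>p\<close> at the other points, as \<open>p\<close> is prime and divides no difference of
  distinct points.\<close>

lemma prime_dvd_coeffs:
  fixes F :: "int poly" and p :: int
  assumes "prime p" "finite A" "\<And>a b. a \<in> A \<Longrightarrow> b \<in> A \<Longrightarrow> p dvd a - b \<Longrightarrow> a = b"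
    and "\<And>a. a \<in> A \<Longrightarrow> p dvd poly F a" and "\<And>i. i \<ge> card A \<Longrightarrow> coeff F i = 0"
  shows "p dvd coeff F i"
  using assms(2-)
proof (induction A arbitrary: F i rule: finite_induct)
  case (insert a A)
  let ?G = "synthetic_div F a"
  have eq: "[:-a, 1:] * ?G + [:poly F a:] = F" by (rule synthetic_div_correct')
  have co: "coeff F (Suc i) = coeff ?G i - a * coeff ?G (Suc i)" for i
    by (subst eq[symmetric]) (simp add: algebra_simps)
  have co0: "coeff F 0 = poly F a - a * coeff ?G 0"
    by (subst eq[symmetric]) simp
  have "p dvd coeff ?G i" for i
  proof (rule insert.IH)
    show "x = y" if "x \<in> A" "y \<in> A" "p dvd x - y" for x y
      using that insert.prems(1) by auto
    show "p dvd poly ?G x" if "x \<in> A" for x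
    proof -
      have "poly F x = (x - a) * poly ?G x + poly F a"
        using arg_cong[OF eq, of "\<lambda>q. poly q x"] by (simp add: algebra_simps)
      moreover have "p dvd poly F x" "p dvd poly F a" using insert.prems(2) that by auto
      ultimately have "p dvd (x - a) * poly ?G x" by (metis dvd_add_left_iff)
      moreover have "\<not> p dvd x - a" using insert.prems(1)[of x a] that insert.hyps by auto
      ultimately show ?thesis using \<open>prime p\<close> by (simp add: prime_dvd_mult_iff)
    qed
    show "coeff ?G i = 0" if "i \<ge> card A" for i
    proof -
      have "degree F \<le> card A"
        using insert.prems(3) insert.hyps by (intro degree_le) auto
      show ?thesis
      proof (cases "i > degree ?G")
        case False
        \<comment> \<open>Here \<open>degree F \<le> card A \<le> i \<le> degree ?G\<close>, while
          \<open>?G\<close> has degree one less than \<open>F\<close> unless \<open>F\<close> is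
          constant.\<close>
        then have "degree F = 0"
          using that \<open>degree F \<le> card A\<close> by (simp add: degree_synthetic_div)
        then have "?G = 0" by (simp add: synthetic_div_eq_0_iff)
        then show ?thesis by simp
      qed (rule coeff_eq_0)
    qed
  qed
  then show ?case
    using insert.prems(2)[of a] by (cases i) (auto simp: co co0)
qed simp

lemma mod_sum_cong:
  fixes a b c :: "'a \<Rightarrow> 'b::euclidean_semiring_cancel"
  assumes "\<And>x. x \<in> X \<Longrightarrow> a x mod p = b x mod p"
  shows "(\<Sum>x\<in>X. a x * c x) mod p = (\<Sum>x\<in>X. b x * c x) mod p"
proof -
  have "(\<Sum>x\<in>X. a x * c x mod p) = (\<Sum>x\<in>X. b x * c x mod p)"
    by (intro sum.cong refl mod_mult_cong assms)
  from arg_cong[OF this, of "\<lambda>y. y mod p"] show ?thesis by (simp only: mod_sum_eq)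
qed

text \<open>The difference of the two polynomials has \<open>d\<close> coefficients and vanishes
  modulo \<open>p\<close> on \<open>A\<close>, whose at least \<open>d\<close> points are distinct
  modulo \<open>p\<close> because \<open>n < p\<close>.\<close>

lemma prime_mod_coeffs_unique:
  fixes a b :: "nat \<Rightarrow> nat"
  assumes p: "prime p" "n < p" and A: "A \<subseteq> {1..n}" "d \<le> card A"
    and eq: "\<And>j. j \<in> A \<Longrightarrow> (\<Sum>l<d. a l * j ^ l) mod p = (\<Sum>l<d. b l * j ^ l) mod p"
    and i: "i < d"
  shows "a i mod p = b i mod p"
proof -
  have finA: "finite A" using A finite_subset by auto
  let ?F = "\<Sum>l<d. monom (int (a l) - int (b l)) l"
  have co: "coeff ?F i = (if i < d then int (a i) - int (b i) else 0)" for i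
    by (simp add: coeff_sum)
  have "int p dvd coeff ?F i"
  proof (rule prime_dvd_coeffs[where A = "int ` A"])
    show "prime (int p)" using p by simp
    show "finite (int ` A)" using finA by simp
    show "x = y" if "x \<in> int ` A" "y \<in> int ` A" "int p dvd x - y" for x y
    proof -
      have "0 \<le> x" "x < int p" "0 \<le> y" "y < int p" using that A p(2) by auto
      then show ?thesis using that(3) by (simp flip: mod_eq_dvd_iff)
    qed
    show "int p dvd poly ?F x" if "x \<in> int ` A" for x
    proof -
      obtain j where j: "j \<in> A" "x = int j" using \<open>x \<in> int ` A\<close> by blast
      have "poly ?F x = int (\<Sum>l<d. a l * j ^ l) - int (\<Sum>l<d. b l * j ^ l)"
        by (simp add: poly_sum poly_monom j(2) left_diff_distrib sum_subtractf)
      moreover have "int (\<Sum>l<d. a l * j ^ l) mod int p = int (\<Sum>l<d. b l * j ^ l) mod int p"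
        using eq[OF j(1)] by (simp only: flip: zmod_int)
      ultimately show ?thesis by (simp only: mod_eq_dvd_iff)
    qed
    show "coeff ?F i = 0" if "i \<ge> card (int ` A)" for i
      using that A(2) by (simp add: co card_image)
  qed
  then have "int p dvd int (a i) - int (b i)" using i by (simp add: co)
  then have "int (a i) mod int p = int (b i) mod int p" by (simp add: mod_eq_dvd_iff)
  then show ?thesis by (simp only: flip: zmod_int)
qed

lemma mod_add_right_imp_eq:
  fixes x y :: nat
  assumes "(x + c) mod p = (y + c) mod p" "x < p" "y < p"
  shows "x = y"
proof -
  have "int (x + c) mod int p = int (y + c) mod int p"
    using assms(1) by (simp only: flip: zmod_int)
  then have "int x mod int p = int y mod int p"
    by (simp add: mod_eq_dvd_iff)
  then show ?thesis using assms(2,3) by simp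
qed

lemma sum_lessThan_add:
  fixes g :: "nat \<Rightarrow> 'a::comm_monoid_add"
  shows "(\<Sum>l<t + c. g l) = (\<Sum>l<t. g l) + (\<Sum>s<c. g (t + s))"
  by (induction c) (simp_all add: add.assoc)

text \<open>
  The alphabets of a protocol are sets of numbers, so tuples over \<^term>\<open>{..<p}\<close> are numbered by
  \<open>enc\<close>, with inverse \<open>dec\<close>.
\<close>

definition vecs :: "nat \<Rightarrow> 'i set \<Rightarrow> ('i \<Rightarrow> nat) set" where
  "vecs p I = I \<rightarrow>\<^sub>E {..<p}"

definition enc :: "nat \<Rightarrow> 'i set \<Rightarrow> ('i \<Rightarrow> nat) \<Rightarrow> nat" where
  "enc p I = to_nat_on (vecs p I)"

definition dec :: "nat \<Rightarrow> 'i set \<Rightarrow> nat \<Rightarrow> 'i \<Rightarrow> nat" where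
  "dec p I = from_nat_into (vecs p I)"

definition codes :: "nat \<Rightarrow> 'i set \<Rightarrow> nat set" where
  "codes p I = enc p I ` vecs p I"

text \<open>Addition of the vector \<open>c\<close> modulo \<open>p\<close>, transported to codes.
  Applied to seeds and to user randomness it supplies the injections in the secrecy
  criteria.\<close>

definition translate :: "nat \<Rightarrow> 'i set \<Rightarrow> ('i \<Rightarrow> nat) \<Rightarrow> nat \<Rightarrow> nat" where
  "translate p I c u = enc p I (\<lambda>i\<in>I. (dec p I u i + c i) mod p)"

context
  fixes I :: "'i set" and p :: nat
  assumes I: "finite I" and p: "0 < p"
begin

lemma finite_vecs: "finite (vecs p I)"
  unfolding vecs_def using I by (intro finite_PiE) auto

lemma dec_enc: "v \<in> vecs p I \<Longrightarrow> dec p I (enc p I v) = v"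
  unfolding dec_def enc_def using finite_vecs by (simp add: countable_finite)

lemma enc_in_codes: "v \<in> vecs p I \<Longrightarrow> enc p I v \<in> codes p I"
  unfolding codes_def by simp

lemma dec_in_vecs: "u \<in> codes p I \<Longrightarrow> dec p I u \<in> vecs p I"
  unfolding codes_def using dec_enc by auto

lemma dec_less: "u \<in> codes p I \<Longrightarrow> i \<in> I \<Longrightarrow> dec p I u i < p"
  using dec_in_vecs unfolding vecs_def by (auto dest: PiE_mem)

lemma dec_inject: "u \<in> codes p I \<Longrightarrow> v \<in> codes p I \<Longrightarrow> (\<And>i. i \<in> I \<Longrightarrow> dec p I u i = dec p I v i) \<Longrightarrow> u = v"
proof -
  assume u: "u \<in> codes p I" and v: "v \<in> codes p I" and eq: "\<And>i. i \<in> I \<Longrightarrow> dec p I u i = dec p I v i"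
  have "dec p I u = dec p I v"
    using dec_in_vecs[OF u] dec_in_vecs[OF v] eq unfolding vecs_def by (rule PiE_ext)
  moreover have "enc p I (dec p I x) = x" if "x \<in> codes p I" for x
    using that dec_enc unfolding codes_def by auto
  ultimately show "u = v" using u v by (metis (full_types))
qed

lemma finite_codes: "finite (codes p I)"
  unfolding codes_def using finite_vecs by simp

lemma card_codes: "card (codes p I) = p ^ card I"
proof -
  have "inj_on (enc p I) (vecs p I)" by (rule inj_on_inverseI[of _ "dec p I"]) (rule dec_enc)
  then have "card (codes p I) = card (vecs p I)" unfolding codes_def by (rule card_image)
  then show ?thesis unfolding vecs_def using I by (simp add: card_PiE)
qed

lemma codes_nonempty: "codes p I \<noteq> {}"
proof -
  have "card (codes p I) > 0" unfolding card_codes using p by simp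
  then show ?thesis by force
qed

lemma translate_vec: "(\<lambda>i\<in>I. (dec p I u i + c i) mod p) \<in> vecs p I"
  unfolding vecs_def using p by (intro restrict_PiE_iff[THEN iffD2]) simp

lemma translate_in_codes: "translate p I c u \<in> codes p I"
  unfolding translate_def by (intro enc_in_codes translate_vec)

lemma dec_translate: "i \<in> I \<Longrightarrow> dec p I (translate p I c u) i = (dec p I u i + c i) mod p"
  unfolding translate_def dec_enc[OF translate_vec] by simp

lemma inj_on_translate: "inj_on (translate p I c) (codes p I)"
proof (rule inj_onI)
  fix u v assume u: "u \<in> codes p I" and v: "v \<in> codes p I" and eq: "translate p I c u = translate p I c v"
  show "u = v"
  proof (rule dec_inject[OF u v])
    fix i assume i: "i \<in> I"
    have "(dec p I u i + c i) mod p = (dec p I v i + c i) mod p"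
      using arg_cong[OF eq, of "\<lambda>u. dec p I u i"] by (simp only: dec_translate[OF i])
    then show "dec p I u i = dec p I v i"
      by (rule mod_add_right_imp_eq[OF _ dec_less[OF u i] dec_less[OF v i]])
  qed
qed

end

section \<open>The scheme\<close>

text \<open>The pair \<open>(i, s)\<close> stands for symbol \<open>s\<close> of file
  \<open>i\<close>. Masking polynomials use the exponents below \<open>t\<close>; the marker of the
  requested file has one exponent for each symbol, from \<open>t\<close> on, so that data and masks
  fall on different coefficients of the answers. For \<open>t = 0\<close> there are no masks and the
  seed set is a singleton.\<close>

definition scheme :: "nat \<Rightarrow> nat \<Rightarrow> nat \<Rightarrow> nat \<Rightarrow> nat \<Rightarrow> spir" where
  "scheme p t c n f = \<lparr>
     file_set = codes p {..<c},
     seed_set = codes p {..<t},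
     rand_set = codes p ({1..f} \<times> {..<c} \<times> {..<t}),
     share_set = (\<lambda>_. {..<p}),
     query_set = (\<lambda>_. codes p ({1..f} \<times> {..<c})),
     answer_set = (\<lambda>_. {..<p}),
     share_map = (\<lambda>u. \<lambda>j\<in>{1..n}. (\<Sum>l<t. dec p {..<t} u l * j ^ l) mod p),
     query_map = (\<lambda>k w. \<lambda>j\<in>{1..n}. enc p ({1..f} \<times> {..<c})
       (\<lambda>x\<in>{1..f} \<times> {..<c}.
         ((\<Sum>l<t. dec p ({1..f} \<times> {..<c} \<times> {..<t}) w (fst x, snd x, l) * j ^ l) +
           (if fst x = k then j ^ (t + snd x) else 0)) mod p)),
     answer_map = (\<lambda>j q m \<tau>.
       ((\<Sum>x\<in>{1..f} \<times> {..<c}. dec p ({1..f} \<times> {..<c}) q x * dec p {..<c} (m (fst x)) (snd x)) + \<tau>) mod p)\<rparr>"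

context
  fixes p t c n f :: nat
  assumes p: "prime p" and n: "n < p" and c: "0 < c" and f: "0 < f"
begin

abbreviation "the_scheme \<equiv> scheme p t c n f"
abbreviation "file_slots \<equiv> {1..f} \<times> {..<c}"
abbreviation "mask_slots \<equiv> {1..f} \<times> {..<c} \<times> {..<t}"

lemma p_pos: "0 < p"
  using p by (rule prime_gt_0_nat)

text \<open>The file-dependent part of the \<open>t\<close> low coefficients, hidden by the shared randomness.\<close>

definition noise :: "nat \<Rightarrow> (nat \<Rightarrow> nat) \<Rightarrow> nat \<Rightarrow> nat" where
  "noise w m l = (\<Sum>x\<in>file_slots. dec p mask_slots w (fst x, snd x, l) * dec p {..<c} (m (fst x)) (snd x))"

text \<open>Coefficients of the polynomial whose value at \<open>j\<close> is the answer of server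
  \<open>j\<close>; they are left unreduced since only their residues modulo \<open>p\<close>
  matter.\<close>

definition answer_coeff :: "nat \<Rightarrow> nat \<Rightarrow> (nat \<Rightarrow> nat) \<Rightarrow> nat \<Rightarrow> nat \<Rightarrow> nat" where
  "answer_coeff k w m u l = (if l < t then dec p {..<t} u l + noise w m l else dec p {..<c} (m k) (l - t))"

lemma query_vec: "(\<lambda>x\<in>file_slots. g x mod p) \<in> vecs p file_slots"
  unfolding vecs_def using p_pos by (intro restrict_PiE_iff[THEN iffD2]) simp

text \<open>Exchanging the sum over slots with the sum over exponents turns the inner product of
  query and files into a single polynomial in \<open>j\<close>; correctness and server secrecy are
  read off from its coefficients.\<close>

lemma answer_scheme:
  assumes j: "j \<in> {1..n}" and k: "k \<in> {1..f}"
  shows "answer the_scheme k w m u j = (\<Sum>l<t + c. answer_coeff k w m u l * j ^ l) mod p"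
proof -
  let ?q = "\<lambda>x. (\<Sum>l<t. dec p mask_slots w (fst x, snd x, l) * j ^ l) + (if fst x = k then j ^ (t + snd x) else 0)"
  let ?F = "\<lambda>x. dec p {..<c} (m (fst x)) (snd x)"
  let ?s = "\<Sum>l<t. dec p {..<t} u l * j ^ l"
  have "answer the_scheme k w m u j = ((\<Sum>x\<in>file_slots. (\<lambda>x\<in>file_slots. ?q x mod p) x * ?F x) + ?s mod p) mod p"
    using j unfolding answer_def scheme_def by (simp add: dec_enc[OF _ p_pos query_vec] del: One_nat_def)
  also have "\<dots> = ((\<Sum>x\<in>file_slots. ?q x * ?F x) + ?s) mod p"
    by (intro mod_add_cong mod_sum_cong) simp_all
  also have "(\<Sum>x\<in>file_slots. ?q x * ?F x) =
      (\<Sum>x\<in>file_slots. \<Sum>l<t. dec p mask_slots w (fst x, snd x, l) * j ^ l * ?F x) +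
      (\<Sum>x\<in>file_slots. (if fst x = k then j ^ (t + snd x) else 0) * ?F x)"
    by (simp only: distrib_right sum.distrib sum_distrib_right)
  also have "(\<Sum>x\<in>file_slots. \<Sum>l<t. dec p mask_slots w (fst x, snd x, l) * j ^ l * ?F x) = (\<Sum>l<t. noise w m l * j ^ l)"
    unfolding noise_def sum_distrib_right by (subst sum.swap) (simp only: mult_ac)
  also have "(\<Sum>x\<in>file_slots. (if fst x = k then j ^ (t + snd x) else 0) * ?F x) =
      (\<Sum>i\<in>{1..f}. \<Sum>s<c. (if i = k then j ^ (t + s) else 0) * dec p {..<c} (m i) s)"
    by (simp only: sum.cartesian_product case_prod_unfold)
  also have "\<dots> = (\<Sum>i\<in>{1..f}. if i = k then (\<Sum>s<c. j ^ (t + s) * dec p {..<c} (m i) s) else 0)"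
    by (intro sum.cong) auto
  also have "\<dots> = (\<Sum>s<c. dec p {..<c} (m k) s * j ^ (t + s))"
    using k by (simp add: mult.commute)
  also have "(\<Sum>l<t. noise w m l * j ^ l) + (\<Sum>s<c. dec p {..<c} (m k) s * j ^ (t + s)) + ?s =
      (\<Sum>l<t + c. answer_coeff k w m u l * j ^ l)"
    unfolding sum_lessThan_add answer_coeff_def
    by (simp add: distrib_right sum.distrib)
  finally show ?thesis .
qed

section \<open>Correctness and secrecy of the scheme\<close>

lemma finite_index: "finite file_slots" "finite mask_slots" "finite {..<c}" "finite {..<t}"
  by auto

lemma scheme_protocol: "spir_protocol n f the_scheme"
proof -
  have card: "card (codes p {..<c}) = p ^ c" using card_codes[OF finite_index(3) p_pos] by simp
  have "p ^ 1 \<le> p ^ c" using p_pos c by (intro power_increasing) auto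
  then have "2 \<le> card (codes p {..<c})" using prime_ge_2_nat[OF p] card by simp
  moreover have "query_map the_scheme k w \<in> (\<Pi>\<^sub>E j\<in>{1..n}. query_set the_scheme j)" for k w
    unfolding scheme_def using enc_in_codes[OF finite_index(1) p_pos query_vec] by simp
  moreover have "share_map the_scheme u \<in> (\<Pi>\<^sub>E j\<in>{1..n}. share_set the_scheme j)" for u
    unfolding scheme_def using p_pos by simp
  ultimately show ?thesis
    unfolding spir_protocol_def
    using finite_codes[OF finite_index(1) p_pos] finite_codes[OF finite_index(2) p_pos]
      finite_codes[OF finite_index(3) p_pos] finite_codes[OF finite_index(4) p_pos]
      codes_nonempty[OF finite_index(2) p_pos] codes_nonempty[OF finite_index(4) p_pos] p_pos
    by (simp add: scheme_def del: One_nat_def)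
qed

text \<open>Any \<open>t + c\<close> answers fix all coefficients modulo \<open>p\<close>. The top
  \<open>c\<close> of them are the symbols of the requested file, already below
  \<open>p\<close>.\<close>

lemma scheme_correct: "correct (t + c) n f the_scheme"
proof (rule correctI[OF scheme_protocol])
  fix k w A m u m' u'
  assume k: "k \<in> {1..f}" and A: "A \<subseteq> {1..n}" "card A \<ge> t + c"
    and m: "m \<in> file_tuples f the_scheme" and m': "m' \<in> file_tuples f the_scheme"
    and eq: "\<And>j. j \<in> A \<Longrightarrow> answer the_scheme k w m u j = answer the_scheme k w m' u' j"
  have mk: "m k \<in> codes p {..<c}" "m' k \<in> codes p {..<c}"
    using m m' k unfolding file_tuples_def scheme_def by (auto dest: PiE_mem)
  show "m k = m' k"
  proof (rule dec_inject[OF finite_index(3) p_pos mk])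
    fix s assume s: "s \<in> {..<c}"
    have "answer_coeff k w m u (t + s) mod p = answer_coeff k w m' u' (t + s) mod p"
    proof (rule prime_mod_coeffs_unique[OF p n A, where a = "answer_coeff k w m u" and b = "answer_coeff k w m' u'"])
      show "(\<Sum>l<t + c. answer_coeff k w m u l * j ^ l) mod p = (\<Sum>l<t + c. answer_coeff k w m' u' l * j ^ l) mod p"
        if "j \<in> A" for j
        using eq[OF that] A(1) that by (subst (1 2) answer_scheme[symmetric, OF _ k]) auto
    qed (use s in simp)
    then show "dec p {..<c} (m k) s = dec p {..<c} (m' k) s"
      using dec_less[OF finite_index(3) p_pos mk(1) s] dec_less[OF finite_index(3) p_pos mk(2) s]
      by (simp add: answer_coeff_def)
  qed
qed

text \<open>A seed shift absorbs any change of the unrequested files, since these enter only the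
  \<open>t\<close> low coefficients, each of which carries a seed symbol of its own.\<close>

lemma scheme_server_secret: "server_secret n f the_scheme"
proof (rule server_secretI[OF scheme_protocol])
  fix k w and m m' :: "nat \<Rightarrow> nat"
  assume k: "k \<in> {1..f}" and eq: "m k = m' k"
  \<comment> \<open>The seed has to make up for the difference of the two noises; the negative term
    is represented by its complement to \<open>p\<close>, to stay in the natural numbers.\<close>
  define b where "b l = noise w m l + (p - noise w m' l mod p)" for l
  let ?\<sigma> = "translate p {..<t} b"
  have seeds: "seed_set the_scheme = codes p {..<t}" by (simp add: scheme_def)
  have "answer the_scheme k w m' (?\<sigma> u) j = answer the_scheme k w m u j" if j: "j \<in> {1..n}" for u j
    unfolding answer_scheme[OF j k]
  proof (rule mod_sum_cong)
    fix l
    show "answer_coeff k w m' (?\<sigma> u) l mod p = answer_coeff k w m u l mod p"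
    proof (cases "l < t")
      case True
      have "answer_coeff k w m' (?\<sigma> u) l mod p = (dec p {..<t} u l + b l + noise w m' l) mod p"
        unfolding answer_coeff_def using True dec_translate[OF finite_index(4) p_pos, of l b u]
        by (simp add: mod_add_left_eq)
      also have "\<dots> = (dec p {..<t} u l + b l + noise w m' l mod p) mod p"
        by (simp add: mod_add_right_eq)
      also have "dec p {..<t} u l + b l + noise w m' l mod p = dec p {..<t} u l + noise w m l + p"
        unfolding b_def using mod_less_divisor[OF p_pos, of "noise w m' l"] by linarith
      finally show ?thesis using True by (simp add: answer_coeff_def)
    qed (simp add: answer_coeff_def eq)
  qed
  then show "\<exists>\<sigma>. inj_on \<sigma> (seed_set the_scheme) \<and> (\<forall>u\<in>seed_set the_scheme. \<sigma> u \<in> seed_set the_scheme \<and>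
      (\<forall>j\<in>{1..n}. answer the_scheme k w m' (\<sigma> u) j = answer the_scheme k w m u j))"
    unfolding seeds using inj_on_translate[OF finite_index(4) p_pos] translate_in_codes[OF finite_index(4) p_pos]
    by (intro exI[of _ ?\<sigma>]) simp
qed

text \<open>
  On the servers of \<open>B\<close> the monomial marking the requested file agrees with a polynomial of degree
  below \<open>t\<close>, so translating the random polynomials exchanges the queries for two files.
\<close>

lemma power_interpolation_mod:
  assumes B: "finite B" "card B \<le> t"
  shows "\<exists>d. (\<forall>l. d l < p) \<and> (\<forall>j\<in>B. (\<Sum>l<t. d l * j ^ l) mod p = j ^ e mod p)"
proof -
  \<comment> \<open>An integer polynomial that agrees with \<open>X^e\<close> on \<open>B\<close>
    and has at most \<open>card B \<le> t\<close> coefficients; their residues modulo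
    \<open>p\<close> give \<open>d\<close>.\<close>
  obtain g where g: "\<forall>b\<in>int ` B. poly g b = poly (monom 1 e) b" "\<forall>i\<ge>card (int ` B). coeff g i = 0"
    using poly_interpolation_int[of "int ` B" "monom 1 e"] B(1) by blast
  have co: "coeff g i = 0" if "i \<ge> t" for i
    using g(2) that B by (simp add: card_image)
  define d where "d l = nat (coeff g l mod int p)" for l
  have intd: "int (d l) = coeff g l mod int p" for l
    unfolding d_def using p_pos by simp
  have "(\<Sum>l<t. d l * j ^ l) mod p = j ^ e mod p" if "j \<in> B" for j
  proof -
    have "int ((\<Sum>l<t. d l * j ^ l) mod p) = (\<Sum>l<t. int (d l) * int j ^ l) mod int p"
      by (simp add: zmod_int)
    also have "\<dots> = (\<Sum>l<t. coeff g l * int j ^ l) mod int p"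
      by (rule mod_sum_cong) (simp add: intd)
    also have "(\<Sum>l<t. coeff g l * int j ^ l) = poly g (int j)"
      unfolding poly_altdef using co by (intro sum.mono_neutral_cong) (auto simp: coeff_eq_0)
    also have "\<dots> = int (j ^ e)" using g(1) that by (simp add: poly_monom)
    finally show ?thesis by (simp only: of_nat_eq_iff flip: zmod_int)
  qed
  moreover have "d l < p" for l
    unfolding d_def using p_pos by (simp add: nat_less_iff)
  ultimately show ?thesis by blast
qed

lemma scheme_user_secret: "user_secret t n f the_scheme"
proof (rule user_secretI[OF scheme_protocol f])
  fix k k' B assume B: "B \<subseteq> {1..n}" "card B \<le> t"
  have "\<forall>s. \<exists>d. (\<forall>l. d l < p) \<and> (\<forall>j\<in>B. (\<Sum>l<t. d l * j ^ l) mod p = j ^ (t + s) mod p)"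
    using B by (intro allI power_interpolation_mod) (auto intro: finite_subset)
  then obtain D where "\<forall>s. (\<forall>l. D s l < p) \<and> (\<forall>j\<in>B. (\<Sum>l<t. D s l * j ^ l) mod p = j ^ (t + s) mod p)"
    unfolding choice_iff by blast
  then have D: "D s l < p" "j \<in> B \<Longrightarrow> (\<Sum>l<t. D s l * j ^ l) mod p = j ^ (t + s) mod p" for s l j
    by auto
  \<comment> \<open>In the slots of file \<open>k\<close>, adding \<open>D\<close> imitates the
    marker on \<open>B\<close>; in those of \<open>k'\<close>, subtracting \<open>D\<close>, as
    \<open>p - D\<close>, cancels the real one. For \<open>k = k'\<close> the two shifts add up to
    \<open>p\<close>.\<close>
  define b :: "nat \<times> nat \<times> nat \<Rightarrow> nat" where "b = (\<lambda>(i, s, l). (if i = k then D s l else 0) + (if i = k' then p - D s l else 0))"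
  let ?\<sigma> = "translate p mask_slots b"
  have rands: "rand_set the_scheme = codes p mask_slots" by (simp add: scheme_def)
  have shift: "((\<Sum>l<t. b (i, s, l) * j ^ l) + (if i = k' then j ^ (t + s) else 0)) mod p =
      (if i = k then j ^ (t + s) else 0) mod p" if j: "j \<in> B" for i s j
  proof -
    \<comment> \<open>\<open>D s l < p\<close> is what makes the truncated subtraction
      exact.\<close>
    have p_sum: "(\<Sum>l<t. D s l * j ^ l) + (\<Sum>l<t. (p - D s l) * j ^ l) = p * (\<Sum>l<t. j ^ l)"
      using less_imp_le[OF D(1)] by (simp add: sum_distrib_left flip: sum.distrib distrib_right)
    consider "i = k" "i = k'" | "i = k" "i \<noteq> k'" | "i \<noteq> k" "i = k'" | "i \<noteq> k" "i \<noteq> k'" by blast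
    then show ?thesis
    proof cases
      case 1
      then show ?thesis using p_sum by (simp add: b_def distrib_right sum.distrib)
    next
      case 2
      then show ?thesis using D(2)[OF j] by (simp add: b_def)
    next
      case 3
      have "((\<Sum>l<t. (p - D s l) * j ^ l) + j ^ (t + s)) mod p =
          ((\<Sum>l<t. (p - D s l) * j ^ l) + (\<Sum>l<t. D s l * j ^ l)) mod p"
        by (rule mod_add_cong[OF refl D(2)[OF j, symmetric]])
      also have "\<dots> = 0" using p_sum by (simp add: add.commute)
      finally show ?thesis using 3 by (simp add: b_def)
    qed (simp add: b_def)
  qed
  have query: "query_map the_scheme k' (?\<sigma> w) j = query_map the_scheme k w j" if j: "j \<in> B" for w j
  proof -
    let ?A = "\<lambda>x. \<Sum>l<t. dec p mask_slots (?\<sigma> w) (fst x, snd x, l) * j ^ l"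
    let ?W = "\<lambda>x. \<Sum>l<t. dec p mask_slots w (fst x, snd x, l) * j ^ l"
    let ?C = "\<lambda>k x. if fst x = k then j ^ (t + snd x) else 0"
    have "(?A x + ?C k' x) mod p = (?W x + ?C k x) mod p" if x: "x \<in> file_slots" for x
    proof -
      have "?A x mod p = (\<Sum>l<t. (dec p mask_slots w (fst x, snd x, l) + b (fst x, snd x, l)) * j ^ l) mod p"
      proof (rule mod_sum_cong)
        fix l assume l: "l \<in> {..<t}"
        have "(fst x, snd x, l) \<in> mask_slots" using x l by (auto simp: mem_Times_iff)
        then show "dec p mask_slots (?\<sigma> w) (fst x, snd x, l) mod p =
            (dec p mask_slots w (fst x, snd x, l) + b (fst x, snd x, l)) mod p"
          by (simp only: dec_translate[OF finite_index(2) p_pos] mod_mod_trivial)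
      qed
      also have "(\<Sum>l<t. (dec p mask_slots w (fst x, snd x, l) + b (fst x, snd x, l)) * j ^ l) =
          ?W x + (\<Sum>l<t. b (fst x, snd x, l) * j ^ l)"
        by (simp only: distrib_right sum.distrib)
      finally have "(?A x + ?C k' x) mod p = (?W x + (\<Sum>l<t. b (fst x, snd x, l) * j ^ l) + ?C k' x) mod p"
        by (rule mod_add_cong[OF _ refl])
      also have "\<dots> = (?W x + ?C k x) mod p"
        unfolding add.assoc by (rule mod_add_cong[OF refl shift[OF j]])
      finally show ?thesis .
    qed
    then show ?thesis
      unfolding scheme_def by (simp cong: restrict_cong)
  qed
  show "\<exists>\<sigma>. inj_on \<sigma> (rand_set the_scheme) \<and> (\<forall>w\<in>rand_set the_scheme. \<sigma> w \<in> rand_set the_scheme \<and>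
      (\<forall>j\<in>B. query_map the_scheme k' (\<sigma> w) j = query_map the_scheme k w j))"
  proof (rule exI[of _ ?\<sigma>], intro conjI ballI)
    show "inj_on ?\<sigma> (rand_set the_scheme)" unfolding rands by (rule inj_on_translate[OF finite_index(2) p_pos])
    show "?\<sigma> w \<in> rand_set the_scheme" for w unfolding rands by (rule translate_in_codes[OF finite_index(2) p_pos])
  qed (rule query)
qed

lemma scheme_csspir: "csspir (t + c) t n f the_scheme"
  unfolding csspir_def
  using scheme_protocol scheme_correct scheme_server_secret scheme_user_secret by blast

lemma card_file_set_scheme: "card (file_set the_scheme) = p ^ c"
  unfolding scheme_def using card_codes[OF finite_index(3) p_pos] by simp

text \<open>Each server returns one symbol modulo \<open>p\<close> and a file has \<open>c\<close>
  symbols, so the logarithm of \<open>p\<close>, nonzero because \<open>p > 1\<close>,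
  cancels.\<close>

lemma pir_rate_scheme: "pir_rate n the_scheme = real c / real n"
proof -
  have "log 2 (real p) \<noteq> 0" using prime_gt_1_nat[OF p] by (intro less_imp_neq[symmetric]) simp
  moreover have "answer_set the_scheme j = {..<p}" for j by (simp add: scheme_def)
  ultimately show ?thesis
    unfolding pir_rate_def card_file_set_scheme using p_pos by (simp add: log_nat_power)
qed

end

section \<open>Achievability and the capacity\<close>

lemma achievable_rate:
  assumes "t < r" "r \<le> n" "0 < f"
  shows "achievable r t n f ((real r - real t) / real n)"
proof -
  \<comment> \<open>A prime above \<open>n\<close> makes the scheme work and one above
    \<open>l\<close> makes the file sizes tend to infinity, while the rate is the same for every
    \<open>l\<close>.\<close>
  have "\<forall>l. \<exists>p. prime p \<and> p > max n l" using bigger_prime by blast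
  then obtain p where p: "\<And>l. prime (p l)" "\<And>l. n < p l" "\<And>l. l < p l"
    unfolding choice_iff by auto
  have c: "0 < r - t" using assms(1) by simp
  have "t + (r - t) = r" using assms(1) by simp
  then have "csspir r t n f (scheme (p l) t (r - t) n f)" for l
    using scheme_csspir[OF p(1)[of l] p(2)[of l] c assms(3), where t = t] by simp
  moreover have "l \<le> card (file_set (scheme (p l) t (r - t) n f))" for l
  proof -
    have "p l ^ 1 \<le> p l ^ (r - t)" using c p(3)[of l] by (intro power_increasing) auto
    then show ?thesis using p(3)[of l] card_file_set_scheme[OF p(1)[of l] p(2)[of l] c assms(3), where t = t] by simp
  qed
  then have "filterlim (\<lambda>l. card (file_set (scheme (p l) t (r - t) n f))) at_top sequentially"
    by (intro filterlim_at_top_mono[OF filterlim_ident]) simp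
  moreover have "pir_rate n (scheme (p l) t (r - t) n f) = (real r - real t) / real n" for l
    using pir_rate_scheme[OF p(1)[of l] p(2)[of l] c assms(3), where t = t] assms(1) by simp
  ultimately show ?thesis unfolding achievable_def
    by (intro exI[of _ "\<lambda>l. scheme (p l) t (r - t) n f"]) simp
qed

theorem corollary4:
  fixes n r t f :: nat
  assumes "t < r" and "r \<le> n" and "f \<ge> 2"
  shows "csspir_capacity r t n f = ereal ((real r - real t) / real n)"
  unfolding csspir_capacity_def
proof (rule antisym)
  show "(SUP \<rho>\<in>{\<rho>. achievable r t n f \<rho>}. ereal \<rho>) \<le> ereal ((real r - real t) / real n)"
  proof (rule SUP_least)
    fix \<rho> assume "\<rho> \<in> {\<rho>. achievable r t n f \<rho>}"
    then obtain P where "\<And>l. csspir r t n f (P l)" "(\<lambda>l. pir_rate n (P l)) \<longlonglongrightarrow> \<rho>"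
      unfolding achievable_def by blast
    \<comment> \<open>Each protocol in the sequence obeys the converse bound, so the limit of the
      rates does as well.\<close>
    then have "\<rho> \<le> (real r - real t) / real n"
      using csspir_rate_le[OF _ assms(3,1,2)] by (intro LIMSEQ_le_const2) auto
    then show "ereal \<rho> \<le> ereal ((real r - real t) / real n)" by simp
  qed
  show "ereal ((real r - real t) / real n) \<le> (SUP \<rho>\<in>{\<rho>. achievable r t n f \<rho>}. ereal \<rho>)"
    using achievable_rate[OF assms(1,2), of f] assms(3) by (intro SUP_upper) simp
qed

end
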